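(* Assume the following. (U1) $u$ is strictly concave, increasing, continuous at zero, and $u(0)=0$. (U2) There is a constant $d>0$ with $u(a)\le d\,w(a,\theta)$ for all $\theta\in\mathcal S$, $a\in[0,\infty)$. (U3) $u$ is continuously differentiable on $(0,\infty)$. (U4) $u'_+(0)=\infty$, where $u'_+(0)$ is the right-hand derivative of $u$ at $0$. (F1) For every $z\ge 0$ and $\theta\in\mathcal S$ the function $f(\theta,\cdot,z)$ is non-decreasing, continuous and concave, and for every $y\ge 0$ and $\theta\in\mathcal S$ the function $f(\theta,y,\cdot)$ is Borel measurable. (F2) There is a constant $\alpha\in(0,1/\beta)$ with $\sup_{y\in[0,x]}\sup_{\theta'\in\mathcal S}\int_{[0,\infty)}w(f(\theta,y,z),\theta')\,\nu(dz)\le\alpha\,w(x,\theta)$ for all $\theta\in\mathcal S$, $x\in[0,\infty)$. (F3) For each $z\in[0,\infty)$, $\theta\in\mathcal S$, the function $f(\theta,\cdot,z)$ is continuously differentiable on $(0,\infty)$. (F4) $f(\theta,0,z)=0$ for all $z\ge0$ and $\theta\in\mathcal S$. (F5) For $\nu$-almost every $z$ there is $y>0$ such that $f'(\theta,y,z)>0$ for all $\theta\in\mathcal S$, where $f'(\theta,y,z):=\partial f(\theta,y,z)/\partial y$. Then: (a) For any $x\in(0,\infty)$ and $\theta\in\mathcal S$ the following Euler equation holds: $$u'(c^*(x,\theta))=\beta\,\frac{\sum_{\theta'\in\mathcal S}p_{\theta\theta'}\int_{[0,\infty)}u'\big(c^*(f(\theta,\phi^*(x,\theta),z),\theta')\big)\,f'(\theta,\phi^*(x,\theta),z)\,e^{-\gamma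 V(f(\theta,\phi^*(x,\theta),z),\theta')}\,\nu(dz)}{\sum_{\theta'\in\mathcal S}p_{\theta\theta'}\int_{[0,\infty)}e^{-\gamma V(f(\theta,\phi^*(x,\theta),z),\theta')}\,\nu(dz)}.$$ (b) For each $\theta\in\mathcal S$, the functions $x\mapsto\phi^*(x,\theta)$ and $x\mapsto c^*(x,\theta)$ are increasing.
   Context: Data: $\mathcal S$ is a finite nonempty set (regimes); $p=(p_{\theta\theta'})_{\theta,\theta'\in\mathcal S}$ is a transition probability (stochastic) matrix; $\nu$ is a Borel probability measure on $[0,\infty)$; $\beta\in(0,1)$ is the discount factor; $\gamma>0$ is the risk-sensitivity parameter; $u:[0,\infty)\to[0,\infty)$ is the utility function; $f:\mathcal S\times[0,\infty)\times[0,\infty)\to[0,\infty)$ is the production function; $w:[0,\infty)\times\mathcal S\to[1,\infty)$ is continuous and, for each $\theta$, non-decreasing in its first variable. "Increasing" means strictly increasing, as opposed to "non-decreasing". Function spaces: for Borel measurable $v:[0,\infty)\times\mathcal S\to\mathbb R$ let $\|v\|_w:=\sup_{x\ge0,\theta\in\mathcal S}|v(x,\theta)|/w(x,\theta)$; $\mathcal B$ is the set of Borel measurable $v:[0,\infty)\times\mathcal S\to\mathbb R$ with $\|v\|_w<\infty$ such that for each $\theta$ the function $v(\cdot,\theta)$ is non-decreasing, non-negative, continuous and concave. $\Phi$ is the set of Borel measurable $\phi:[0,\infty)\times\mathcal S\to[0,\infty)$ with $0\le\phi(x,\theta)\le x$. Value function and optimal policy: $V$ denotes the unique function in $\mathcal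 B$ satisfying $$V(x,\theta)=\sup_{y\in[0,x]}\left(u(x-y)-\frac{\beta}{\gamma}\ln\left[\sum_{\theta'\in\mathcal S}p_{\theta\theta'}\int_{[0,\infty)}e^{-\gamma V(f(\theta,y,z),\theta')}\,\nu(dz)\right]\right)$$ for all $x\in[0,\infty)$, $\theta\in\mathcal S$; $\phi^*$ denotes the unique element of $\Phi$ such that for all $x,\theta$ the supremum is attained at $y=\phi^*(x,\theta)$; and $c^*(x,\theta):=x-\phi^*(x,\theta)$. (Under (U1)-(U2), (F1)-(F2), the existence and uniqueness of $V$ and $\phi^*$ is an earlier result of the paper.) *)

theory Defs
  imports "HOL-Probability.Probability"
begin

text \<open>
  The regimes are the elements of a type \<open>'s\<close> of class \<open>finite\<close>.  The half-line \<open>[0, \<infinity>)\<close> is the set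
  \<open>{0..}\<close> of reals; functions on it are total functions on \<open>real\<close> whose values at negative arguments
  are irrelevant, and a function of \<open>(x, \<theta>)\<close> is curried.
\<close>

definition strictly_concave_on :: "real set \<Rightarrow> (real \<Rightarrow> real) \<Rightarrow> bool" where
  "strictly_concave_on A g \<longleftrightarrow> convex A \<and>
     (\<forall>x\<in>A. \<forall>y\<in>A. \<forall>t. x \<noteq> y \<longrightarrow> 0 < t \<longrightarrow> t < 1 \<longrightarrow>
        (1 - t) * g x + t * g y < g ((1 - t) * x + t * y))"

definition stochastic_matrix :: "('s::finite \<Rightarrow> 's \<Rightarrow> real) \<Rightarrow> bool" where
  "stochastic_matrix p \<longleftrightarrow> (\<forall>\<theta> \<theta>'. 0 \<le> p \<theta> \<theta>') \<and> (\<forall>\<theta>. (\<Sum>\<theta>'\<in>UNIV. p \<theta> \<theta>') = 1)"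

definition prob_on_halfline :: "real measure \<Rightarrow> bool" where
  "prob_on_halfline \<nu> \<longleftrightarrow> prob_space \<nu> \<and> sets \<nu> = sets (restrict_space borel {0..})"

definition state_space :: "(real \<times> 's::finite) measure" where
  "state_space = restrict_space borel {0..} \<Otimes>\<^sub>M count_space UNIV"

text \<open>Continuity on \<open>[0, \<infinity>) \<times> S\<close>, with \<open>S\<close> discrete, is continuity in the first variable.\<close>

definition weight_function :: "(real \<Rightarrow> 's::finite \<Rightarrow> real) \<Rightarrow> bool" where
  "weight_function w \<longleftrightarrow>
     (\<forall>x\<ge>0. \<forall>\<theta>. 1 \<le> w x \<theta>) \<and>
     (\<forall>\<theta>. continuous_on {0..} (\<lambda>x. w x \<theta>) \<and> mono_on {0..} (\<lambda>x. w x \<theta>))"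

definition wnorm :: "(real \<Rightarrow> 's::finite \<Rightarrow> real) \<Rightarrow> (real \<Rightarrow> 's \<Rightarrow> real) \<Rightarrow> ereal" where
  "wnorm w v = (SUP (x, \<theta>) \<in> {0..} \<times> UNIV. ereal (\<bar>v x \<theta>\<bar> / w x \<theta>))"

definition value_space :: "(real \<Rightarrow> 's::finite \<Rightarrow> real) \<Rightarrow> (real \<Rightarrow> 's \<Rightarrow> real) set" where
  "value_space w = {v.
     (\<lambda>(x, \<theta>). v x \<theta>) \<in> borel_measurable state_space \<and>
     wnorm w v < \<infinity> \<and>
     (\<forall>\<theta>. mono_on {0..} (\<lambda>x. v x \<theta>) \<and> (\<forall>x\<ge>0. 0 \<le> v x \<theta>) \<and>
          continuous_on {0..} (\<lambda>x. v x \<theta>) \<and> concave_on {0..} (\<lambda>x. v x \<theta>))}"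

definition policy_space :: "(real \<Rightarrow> 's::finite \<Rightarrow> real) set" where
  "policy_space = {\<phi>.
     (\<lambda>(x, \<theta>). \<phi> x \<theta>) \<in> borel_measurable state_space \<and>
     (\<forall>x\<ge>0. \<forall>\<theta>. 0 \<le> \<phi> x \<theta> \<and> \<phi> x \<theta> \<le> x)}"

definition bellman_objective ::
  "('s::finite \<Rightarrow> 's \<Rightarrow> real) \<Rightarrow> real measure \<Rightarrow> real \<Rightarrow> real \<Rightarrow> (real \<Rightarrow> real) \<Rightarrow>
   ('s \<Rightarrow> real \<Rightarrow> real \<Rightarrow> real) \<Rightarrow> (real \<Rightarrow> 's \<Rightarrow> real) \<Rightarrow> real \<Rightarrow> 's \<Rightarrow> real \<Rightarrow> real" where
  "bellman_objective p \<nu> \<beta> \<gamma> u f v x \<theta> y =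
     u (x - y) - \<beta> / \<gamma> *
       ln (\<Sum>\<theta>'\<in>UNIV. p \<theta> \<theta>' * (\<integral>z. exp (- \<gamma> * v (f \<theta> y z) \<theta>') \<partial>\<nu>))"

text \<open>
  The supremum is a real \<open>Sup\<close>.  For \<open>v\<close> in \<open>value_space w\<close> and under the growth conditions on
  \<open>u\<close> and \<open>f\<close> the set is bounded above (Jensen's inequality), so no default value is involved.
\<close>

definition is_value_function ::
  "('s::finite \<Rightarrow> 's \<Rightarrow> real) \<Rightarrow> real measure \<Rightarrow> real \<Rightarrow> real \<Rightarrow> (real \<Rightarrow> real) \<Rightarrow>
   ('s \<Rightarrow> real \<Rightarrow> real \<Rightarrow> real) \<Rightarrow> (real \<Rightarrow> 's \<Rightarrow> real) \<Rightarrow> (real \<Rightarrow> 's \<Rightarrow> real) \<Rightarrow> bool" where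
  "is_value_function p \<nu> \<beta> \<gamma> u f w V \<longleftrightarrow>
     V \<in> value_space w \<and>
     (\<forall>x\<ge>0. \<forall>\<theta>. V x \<theta> = (SUP y\<in>{0..x}. bellman_objective p \<nu> \<beta> \<gamma> u f V x \<theta> y))"

definition is_optimal_policy ::
  "('s::finite \<Rightarrow> 's \<Rightarrow> real) \<Rightarrow> real measure \<Rightarrow> real \<Rightarrow> real \<Rightarrow> (real \<Rightarrow> real) \<Rightarrow>
   ('s \<Rightarrow> real \<Rightarrow> real \<Rightarrow> real) \<Rightarrow> (real \<Rightarrow> 's \<Rightarrow> real) \<Rightarrow> (real \<Rightarrow> 's \<Rightarrow> real) \<Rightarrow> bool" where
  "is_optimal_policy p \<nu> \<beta> \<gamma> u f V \<phi> \<longleftrightarrow>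
     \<phi> \<in> policy_space \<and>
     (\<forall>x\<ge>0. \<forall>\<theta>. bellman_objective p \<nu> \<beta> \<gamma> u f V x \<theta> (\<phi> x \<theta>) =
        (SUP y\<in>{0..x}. bellman_objective p \<nu> \<beta> \<gamma> u f V x \<theta> y))"

definition consumption :: "(real \<Rightarrow> 's \<Rightarrow> real) \<Rightarrow> real \<Rightarrow> 's \<Rightarrow> real" where
  "consumption \<phi> x \<theta> = x - \<phi> x \<theta>"

definition prod_deriv :: "('s \<Rightarrow> real \<Rightarrow> real \<Rightarrow> real) \<Rightarrow> 's \<Rightarrow> real \<Rightarrow> real \<Rightarrow> real" where
  "prod_deriv f \<theta> y z = deriv (\<lambda>t. f \<theta> t z) y"

text \<open>
  The integrand in the numerator of the Euler equation.  \<open>deriv u\<close> has no meaning at \<open>0\<close>, but for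
  \<open>x > 0\<close> that value enters only on the \<open>\<nu>\<close>-null set where next-period income \<open>f \<theta> (\<phi> x \<theta>) z\<close>
  vanishes.
\<close>

definition euler_integrand ::
  "real \<Rightarrow> (real \<Rightarrow> real) \<Rightarrow> ('s \<Rightarrow> real \<Rightarrow> real \<Rightarrow> real) \<Rightarrow> (real \<Rightarrow> 's \<Rightarrow> real) \<Rightarrow>
   (real \<Rightarrow> 's \<Rightarrow> real) \<Rightarrow> real \<Rightarrow> 's \<Rightarrow> 's \<Rightarrow> real \<Rightarrow> real" where
  "euler_integrand \<gamma> u f V \<phi> x \<theta> \<theta>' z =
     deriv u (consumption \<phi> (f \<theta> (\<phi> x \<theta>) z) \<theta>') *
     prod_deriv f \<theta> (\<phi> x \<theta>) z *
     exp (- \<gamma> * V (f \<theta> (\<phi> x \<theta>) z) \<theta>')"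

text \<open>
  The Bochner integral of a non-integrable function is \<open>0\<close>, so integrability is part of the claim.
\<close>

definition euler_equation ::
  "('s::finite \<Rightarrow> 's \<Rightarrow> real) \<Rightarrow> real measure \<Rightarrow> real \<Rightarrow> real \<Rightarrow> (real \<Rightarrow> real) \<Rightarrow>
   ('s \<Rightarrow> real \<Rightarrow> real \<Rightarrow> real) \<Rightarrow> (real \<Rightarrow> 's \<Rightarrow> real) \<Rightarrow> (real \<Rightarrow> 's \<Rightarrow> real) \<Rightarrow>
   real \<Rightarrow> 's \<Rightarrow> bool" where
  "euler_equation p \<nu> \<beta> \<gamma> u f V \<phi> x \<theta> \<longleftrightarrow>
     (\<forall>\<theta>'. integrable \<nu> (euler_integrand \<gamma> u f V \<phi> x \<theta> \<theta>')) \<and>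
     deriv u (consumption \<phi> x \<theta>) =
       \<beta> * ((\<Sum>\<theta>'\<in>UNIV. p \<theta> \<theta>' * (\<integral>z. euler_integrand \<gamma> u f V \<phi> x \<theta> \<theta>' z \<partial>\<nu>)) /
            (\<Sum>\<theta>'\<in>UNIV. p \<theta> \<theta>' * (\<integral>z. exp (- \<gamma> * V (f \<theta> (\<phi> x \<theta>) z) \<theta>') \<partial>\<nu>)))"

end

theory Submission
  imports Defs
begin

text \<open>
  Write \<open>V x \<theta>\<close> as the maximum over \<open>y\<close> of \<open>u (x - y) + h \<theta> y\<close>.  The continuation value \<open>h\<close> is concave by
  the Hoelder inequality.  The infinite slope of \<open>u\<close> at \<open>0\<close> forces an interior optimum, so \<open>V\<close> is
  differentiable with \<open>V' = u' \<circ> c\<close> by an envelope argument, hence \<open>h\<close> is differentiable by dominated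
  convergence, and the Euler equation is the first-order condition \<open>u' (c x) = h' (\<phi> x)\<close>.  As \<open>u'\<close> is
  decreasing and \<open>h'\<close> non-increasing, \<open>\<phi>\<close> is increasing and \<open>c\<close> non-decreasing.

  If \<open>c\<close> were constant on an interval, \<open>V\<close> would be affine there.  The equality case of the Hoelder
  inequality then produces an interval for the next period on which \<open>V\<close> is again affine and its
  increment is multiplied by \<open>1 / \<beta>\<close>, while the weight grows at most by a factor \<open>\<alpha> < 1 / \<beta>\<close>.
  Iterating contradicts the bound of \<open>V\<close> by a multiple of \<open>w\<close>.
\<close>

section \<open>Concave functions\<close>

lemma concave_on_below_tangent:
  fixes g :: "real \<Rightarrow> real"
  assumes "concave_on {0..} g" "0 < c" "0 \<le> x" "(g has_real_derivative d) (at c)"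
  shows "g x \<le> g c + d * (x - c)"
proof -
  have "((\<lambda>x. - g x) has_real_derivative - d) (at c within {0..})"
    using assms(4) by (intro derivative_intros) (rule has_field_derivative_at_within)
  then have "(- g x) - (- g c) \<ge> (- d) * (x - c)"
    using assms by (intro convex_on_imp_above_tangent[where A = "{0..}"])
      (auto simp: concave_on_def interior_real_atLeast)
  then show ?thesis by (simp add: algebra_simps)
qed

lemma strictly_concave_on_imp_concave_on:
  assumes "strictly_concave_on A g"
  shows "concave_on A g"
  unfolding concave_on_iff
proof (intro conjI ballI allI impI)
  show "convex A" using assms by (simp add: strictly_concave_on_def)
  fix x y :: real and s t :: real
  assume *: "x \<in> A" "y \<in> A" "0 \<le> s" "0 \<le> t" "s + t = 1"
  then have s: "s = 1 - t" by simp
  show "s * g x + t * g y \<le> g (s *\<^sub>R x + t *\<^sub>R y)"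
  proof (cases "x = y \<or> t = 0 \<or> t = 1")
    case True
    then show ?thesis using distrib_right[of s t "g y"] distrib_right[of s t y] * by auto
  next
    case False
    then have "(1 - t) * g x + t * g y < g ((1 - t) * x + t * y)"
      using assms * s unfolding strictly_concave_on_def by (metis le_less diff_ge_0_iff_ge)
    then show ?thesis using s by simp
  qed
qed

lemma strictly_concave_on_mid:
  assumes "strictly_concave_on A g" "x \<in> A" "y \<in> A" "x \<noteq> y"
  shows "(g x + g y) / 2 < g ((x + y) / 2)"
proof -
  have "\<forall>t. x \<noteq> y \<longrightarrow> 0 < t \<longrightarrow> t < 1 \<longrightarrow> (1 - t) * g x + t * g y < g ((1 - t) * x + t * y)"
    using assms by (simp add: strictly_concave_on_def)
  from spec[OF this, of "1 / 2"] assms(4) show ?thesis by (simp add: add_divide_distrib)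
qed

text \<open>The midpoint value lies strictly above the chord and weakly below the tangent; comparing
  the two gives strictness at the far end.\<close>

lemma strictly_concave_on_below_tangent:
  fixes g :: "real \<Rightarrow> real"
  assumes "strictly_concave_on {0..} g" "0 < c" "0 \<le> x" "x \<noteq> c" "(g has_real_derivative d) (at c)"
  shows "g x < g c + d * (x - c)"
proof -
  have "(g x + g c) / 2 < g ((x + c) / 2)"
    using assms by (intro strictly_concave_on_mid) auto
  moreover have "g ((x + c) / 2) \<le> g c + d * ((x + c) / 2 - c)"
    using assms by (intro concave_on_below_tangent strictly_concave_on_imp_concave_on) auto
  ultimately show ?thesis by (simp add: field_simps)
qed

lemma concave_on_mid:
  fixes g :: "real \<Rightarrow> real"
  assumes "concave_on {0..} g" "0 \<le> x" "0 \<le> y"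
  shows "(g x + g y) / 2 \<le> g ((x + y) / 2)"
  using concave_onD[OF assms(1), of "1/2" x y] assms by (simp add: add_divide_distrib)

text \<open>The envelope argument of Benveniste and Scheinkman.\<close>

lemma concave_on_has_derivative_of_minorant:
  fixes g :: "real \<Rightarrow> real"
  assumes conc: "concave_on {0..} g" and x0: "0 < x0"
    and W: "(W has_real_derivative d) (at x0)" "W x0 = g x0"
    and le: "eventually (\<lambda>x. W x \<le> g x) (at x0)"
  shows "(g has_real_derivative d) (at x0)"
proof -
  have le': "eventually (\<lambda>x. W x \<le> g x) (nhds x0)"
    using le W(2) by (auto simp: eventually_nhds_conv_at)
  \<comment> \<open>\<open>x0\<close> is a convex combination of \<open>x\<close> and the point
    \<open>x0 - t * (x - x0)\<close> on its other side. Concavity bounds \<open>g x\<close> through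
    the value of \<open>g\<close> there, hence through that of the minorant \<open>W\<close>; then
    \<open>t\<close> tends to \<open>0\<close>.\<close>
  have upper: "g x \<le> g x0 + d * (x - x0)" if x: "0 \<le> x" for x
  proof -
    have "((\<lambda>t. x0 - t * (x - x0)) has_real_derivative - (x - x0)) (at 0)"
      by (auto intro!: derivative_eq_intros)
    moreover have "(W has_real_derivative d) (at (x0 - 0 * (x - x0)))"
      using W by simp
    ultimately have "((\<lambda>t. W (x0 - t * (x - x0))) has_real_derivative d * (- (x - x0))) (at 0)"
      by (rule DERIV_chain2[rotated])
    then have "((\<lambda>t. (W (x0 - t * (x - x0)) - g x0) / t) \<longlongrightarrow> d * (- (x - x0))) (at_right 0)"
      using W(2) by (auto simp: has_field_derivative_iff intro: filterlim_at_within_not_equal tendsto_within_subset)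
    then have lim: "((\<lambda>t. g x0 - (W (x0 - t * (x - x0)) - g x0) / t) \<longlongrightarrow> g x0 - d * (- (x - x0)))
        (at_right 0)"
      by (intro tendsto_intros)
    have t0: "((\<lambda>t. x0 - t * (x - x0)) \<longlongrightarrow> x0 - 0 * (x - x0)) (at_right 0)"
      by (intro tendsto_intros)
    then have "eventually (\<lambda>t. W (x0 - t * (x - x0)) \<le> g (x0 - t * (x - x0))) (at_right 0)"
      using le' by (auto simp: filterlim_iff)
    moreover have "eventually (\<lambda>t. 0 < x0 - t * (x - x0)) (at_right 0)"
      using t0 x0 by (intro order_tendstoD(1)[OF t0]) auto
    moreover have "eventually (\<lambda>t. 0 < (t::real)) (at_right 0)"
      by (simp add: eventually_at_right_less)
    ultimately have "eventually (\<lambda>t. g x \<le> g x0 - (W (x0 - t * (x - x0)) - g x0) / t) (at_right 0)"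
    proof eventually_elim
      case (elim t)
      let ?y = "x0 - t * (x - x0)"
      have c: "1 - 1 / (1 + t) = t / (1 + t)" using elim by (simp add: field_simps)
      have "(t / (1 + t)) *\<^sub>R x + (1 / (1 + t)) *\<^sub>R ?y = x0"
        using elim by (simp add: divide_simps) (simp add: algebra_simps)
      then have "(t / (1 + t)) * g x + (1 / (1 + t)) * g ?y \<le> g x0"
        using concave_onD[OF conc, of "1 / (1 + t)" x ?y] elim x unfolding c by simp
      then have "t * g x + g ?y \<le> (1 + t) * g x0"
        using elim by (simp add: divide_simps) (simp add: algebra_simps)
      then show ?case using elim by (simp add: field_simps)
    qed
    then have "g x \<le> g x0 - d * (- (x - x0))"
      by (intro tendsto_lowerbound[OF lim]) auto
    then show ?thesis by (simp add: algebra_simps)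
  qed
  \<comment> \<open>The deviation of \<open>g\<close> from the tangent is at most \<open>0\<close>
    by \<open>upper\<close> and at least that of \<open>W\<close>, so the error of \<open>W\<close>
    dominates it.\<close>
  have "((\<lambda>x. (g x - g x0) / (x - x0) - d) \<longlongrightarrow> 0) (at x0)"
  proof (rule Lim_null_comparison)
    have "((\<lambda>x. (W x - W x0) / (x - x0) - d) \<longlongrightarrow> 0) (at x0)"
      using W(1) by (auto simp: has_field_derivative_iff LIM_zero_iff)
    then show "((\<lambda>x. \<bar>(W x - W x0) / (x - x0) - d\<bar>) \<longlongrightarrow> 0) (at x0)"
      by (rule tendsto_rabs_zero)
    have "eventually (\<lambda>x. 0 < x) (at x0)"
      using x0 by (intro order_tendstoD(1)[OF tendsto_ident_at])
    moreover have "eventually (\<lambda>x. x \<noteq> x0) (at x0)"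
      by (simp add: eventually_at_filter)
    ultimately show "eventually (\<lambda>x. norm ((g x - g x0) / (x - x0) - d)
        \<le> \<bar>(W x - W x0) / (x - x0) - d\<bar>) (at x0)"
      using le
    proof eventually_elim
      case (elim x)
      have eq: "\<bar>a / (x - x0) - d\<bar> = \<bar>a - d * (x - x0)\<bar> / \<bar>x - x0\<bar>" for a
        using elim by (simp add: field_simps flip: abs_divide)
      have "\<bar>g x - g x0 - d * (x - x0)\<bar> \<le> \<bar>W x - W x0 - d * (x - x0)\<bar>"
        using upper[of x] elim W(2) by (auto simp: abs_if)
      then show ?case unfolding real_norm_def eq by (rule divide_right_mono) simp
    qed
  qed
  then show ?thesis by (simp add: has_field_derivative_iff LIM_zero_iff)
qed

text \<open>As \<open>g 0\<close> is non-negative, the slope \<open>g y / y\<close> of the ray from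
  the origin is non-increasing; the statement is this without division.\<close>

lemma concave_on_scale:
  fixes g :: "real \<Rightarrow> real"
  assumes "concave_on {0..} g" "0 \<le> g 0" "0 < s" "s \<le> y"
  shows "s * g y \<le> y * g s"
proof -
  have "(1 - s / y) * g 0 + (s / y) * g y \<le> g ((1 - s / y) *\<^sub>R 0 + (s / y) *\<^sub>R y)"
    using concave_onD[OF assms(1), of "s / y" 0 y] assms by simp
  moreover have "0 \<le> (1 - s / y) * g 0" using assms by simp
  ultimately show ?thesis using assms by (simp add: field_simps)
qed

text \<open>Increments beyond \<open>a\<close> are controlled by ray slopes, the largest of which is
  \<open>g a / a\<close>. The constant involves only a value of \<open>g\<close>, so it stays
  integrable when \<open>g\<close> depends on the shock.\<close>

lemma concave_on_lipschitz_away_from_0: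
  fixes g :: "real \<Rightarrow> real"
  assumes conc: "concave_on {0..} g" and mono: "mono_on {0..} g" and nonneg: "0 \<le> g 0"
    and a: "0 < a" and yy': "a \<le> y" "a \<le> y'"
  shows "\<bar>g y' - g y\<bar> \<le> \<bar>y' - y\<bar> * (g a / a)"
proof -
  note scale = concave_on_scale[OF conc nonneg]
  have *: "\<bar>g y' - g y\<bar> \<le> \<bar>y' - y\<bar> * (g a / a)" if "a \<le> y" "y \<le> y'" for y y'
  proof -
    have "y * g y' \<le> y' * g y" using scale[of y y'] that a by simp
    then have "g y' - g y \<le> (y' - y) * (g y / y)" using that a by (simp add: field_simps)
    also have "\<dots> \<le> (y' - y) * (g a / a)"
      using scale[of a y] that a by (intro mult_left_mono) (simp_all add: field_simps)
    finally show ?thesis using monotone_onD[OF mono, of y y'] that a by simp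
  qed
  show ?thesis using *[of y y'] *[of y' y] yy' by (cases "y \<le> y'") (auto simp: abs_minus_commute)
qed

section \<open>Two inequalities for the exponential function\<close>

lemma exp_mid_less:
  fixes a b :: real
  assumes "a \<noteq> b"
  shows "exp ((a + b) / 2) < (exp a + exp b) / 2"
proof -
  have "0 < (exp (a / 2) - exp (b / 2))\<^sup>2" using assms by simp
  also have "\<dots> = exp a + exp b - 2 * (exp (a / 2) * exp (b / 2))"
    using exp_double[of "a / 2"] exp_double[of "b / 2"] by (simp add: power2_diff)
  finally show ?thesis by (simp add: add_divide_distrib exp_add)
qed

lemma abs_exp_diff_le:
  fixes a b :: real
  assumes "0 \<le> a" "0 \<le> b"
  shows "\<bar>exp (- a) - exp (- b)\<bar> \<le> \<bar>a - b\<bar>"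
proof -
  have *: "exp (- a) - exp (- b) \<le> b - a" if "0 \<le> a" "a \<le> b" for a b :: real
  proof -
    have "exp (- a) - exp (- b) = exp (- a) * (1 - exp (- (b - a)))" by (simp add: algebra_simps flip: exp_add)
    also have "\<dots> \<le> 1 * (b - a)"
    proof (intro mult_mono)
      show "1 - exp (- (b - a)) \<le> b - a" using exp_ge_add_one_self[of "- (b - a)"] by linarith
    qed (use that in auto)
    finally show ?thesis by simp
  qed
  show ?thesis using *[of a b] *[of b a] assms by (cases "a \<le> b") auto
qed

section \<open>The logarithm of the mean exponential\<close>

locale markov_shock = prob_space M for M :: "'a measure" +
  fixes p :: "'s::finite \<Rightarrow> 's \<Rightarrow> real"
  assumes stochastic_p: "stochastic_matrix p"
begin

lemma p_nonneg: "0 \<le> p \<theta> \<theta>'"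
  using stochastic_p by (simp add: stochastic_matrix_def)

lemma sum_p: "(\<Sum>\<theta>'\<in>UNIV. p \<theta> \<theta>') = 1"
  using stochastic_p by (simp add: stochastic_matrix_def)

lemma ex_p_pos: "\<exists>\<theta>'. 0 < p \<theta> \<theta>'"
proof (rule ccontr)
  assume "\<not> (\<exists>\<theta>'. 0 < p \<theta> \<theta>')"
  then have "p \<theta> \<theta>' = 0" for \<theta>' using p_nonneg[of \<theta> \<theta>'] by (metis less_eq_real_def)
  then show False using sum_p[of \<theta>] by simp
qed

definition mean :: "'s \<Rightarrow> ('s \<Rightarrow> 'a \<Rightarrow> real) \<Rightarrow> real" where
  "mean \<theta> g = (\<Sum>\<theta>'\<in>UNIV. p \<theta> \<theta>' * (\<integral>z. g \<theta>' z \<partial>M))"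

lemma mean_cong: "(\<And>\<theta>' z. z \<in> space M \<Longrightarrow> g \<theta>' z = g' \<theta>' z) \<Longrightarrow> mean \<theta> g = mean \<theta> g'"
  unfolding mean_def by (auto intro!: sum.cong Bochner_Integration.integral_cong)

lemma mean_const [simp]: "mean \<theta> (\<lambda>_ _. c) = c"
  by (simp add: mean_def prob_space sum_p flip: sum_distrib_right)

lemma mean_cmult: "mean \<theta> (\<lambda>\<theta>' z. c * g \<theta>' z) = c * mean \<theta> g"
  by (simp add: mean_def sum_distrib_left algebra_simps)

lemma mean_add:
  assumes "\<And>\<theta>'. integrable M (g \<theta>')" "\<And>\<theta>'. integrable M (g' \<theta>')"
  shows "mean \<theta> (\<lambda>\<theta>' z. g \<theta>' z + g' \<theta>' z) = mean \<theta> g + mean \<theta> g'"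
  using assms by (simp add: mean_def sum.distrib distrib_left)

lemma mean_diff:
  assumes "\<And>\<theta>'. integrable M (g \<theta>')" "\<And>\<theta>'. integrable M (g' \<theta>')"
  shows "mean \<theta> (\<lambda>\<theta>' z. g \<theta>' z - g' \<theta>' z) = mean \<theta> g - mean \<theta> g'"
  using assms by (simp add: mean_def sum_subtractf right_diff_distrib)

lemma mean_mono:
  assumes "\<And>\<theta>'. integrable M (g \<theta>')" "\<And>\<theta>'. integrable M (g' \<theta>')"
    and "\<And>\<theta>' z. z \<in> space M \<Longrightarrow> g \<theta>' z \<le> g' \<theta>' z"
  shows "mean \<theta> g \<le> mean \<theta> g'"
  using assms by (auto simp: mean_def p_nonneg intro!: sum_mono mult_left_mono integral_mono)

text \<open>A vanishing sum of non-negative terms has vanishing terms; a positive transition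
  probability passes this on to the integral.\<close>

lemma AE_eq_0_if_mean_eq_0:
  assumes int: "\<And>\<theta>'. integrable M (g \<theta>')"
    and nonneg: "\<And>\<theta>' z. z \<in> space M \<Longrightarrow> 0 \<le> g \<theta>' z"
    and "mean \<theta> g = 0" "0 < p \<theta> \<theta>'"
  shows "AE z in M. g \<theta>' z = 0"
proof -
  have "0 \<le> p \<theta> \<theta>' * (\<integral>z. g \<theta>' z \<partial>M)" for \<theta>'
    using nonneg by (intro mult_nonneg_nonneg p_nonneg integral_nonneg) auto
  then have "p \<theta> \<theta>' * (\<integral>z. g \<theta>' z \<partial>M) = 0"
    using assms(3) unfolding mean_def by (subst (asm) sum_nonneg_eq_0_iff) auto
  then have "(\<integral>z. g \<theta>' z \<partial>M) = 0" using assms(4) by simp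
  then show ?thesis
    using integral_nonneg_eq_0_iff_AE[OF int] nonneg by auto
qed

lemma mean_exp_pos:
  assumes "\<And>\<theta>'. integrable M (\<lambda>z. exp (X \<theta>' z :: real))"
  shows "0 < mean \<theta> (\<lambda>\<theta>' z. exp (X \<theta>' z))"
proof -
  obtain \<theta>' where "0 < p \<theta> \<theta>'" using ex_p_pos by blast
  then have "mean \<theta> (\<lambda>\<theta>' z. exp (X \<theta>' z)) \<noteq> 0"
    using AE_eq_0_if_mean_eq_0[where g = "\<lambda>\<theta>' z. exp (X \<theta>' z)" and \<theta> = \<theta> and \<theta>' = \<theta>'] assms by auto
  moreover have "0 \<le> mean \<theta> (\<lambda>\<theta>' z. exp (X \<theta>' z))"
    unfolding mean_def by (intro sum_nonneg mult_nonneg_nonneg p_nonneg integral_nonneg) auto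
  ultimately show ?thesis by simp
qed

definition log_mean_exp :: "'s \<Rightarrow> ('s \<Rightarrow> 'a \<Rightarrow> real) \<Rightarrow> real" where
  "log_mean_exp \<theta> X = ln (mean \<theta> (\<lambda>\<theta>' z. exp (X \<theta>' z)))"

lemma mean_exp_diff:
  "mean \<theta> (\<lambda>\<theta>' z. exp (X \<theta>' z - c)) = mean \<theta> (\<lambda>\<theta>' z. exp (X \<theta>' z)) / exp c"
  using mean_cmult[of \<theta> "1 / exp c" "\<lambda>\<theta>' z. exp (X \<theta>' z)"] by (simp add: exp_diff)

lemma mean_exp_diff_log_mean_exp:
  assumes "\<And>\<theta>'. integrable M (\<lambda>z. exp (X \<theta>' z :: real))"
  shows "mean \<theta> (\<lambda>\<theta>' z. exp (X \<theta>' z - log_mean_exp \<theta> X)) = 1"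
  using mean_exp_pos[of X \<theta>] assms unfolding mean_exp_diff log_mean_exp_def by simp

lemma mean_exp_combination:
  assumes "\<And>\<theta>'. integrable M (\<lambda>z. exp (X \<theta>' z :: real))"
    and "\<And>\<theta>'. integrable M (\<lambda>z. exp (X' \<theta>' z :: real))"
  shows "mean \<theta> (\<lambda>\<theta>' z. (1 - t) * exp (X \<theta>' z - log_mean_exp \<theta> X)
      + t * exp (X' \<theta>' z - log_mean_exp \<theta> X')) = 1"
proof -
  have "integrable M (\<lambda>z. exp (X \<theta>' z - c))" "integrable M (\<lambda>z. exp (X' \<theta>' z - c))" for \<theta>' c
    using assms by (simp_all add: exp_diff)
  then show ?thesis
    using assms by (subst mean_add) (simp_all add: mean_cmult mean_exp_diff_log_mean_exp)
qed

text \<open>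
  The Hoelder inequality, by the weighted inequality of arithmetic and geometric means applied to
  the exponentials normalised to mean one; this form also gives the case of equality below.
\<close>

lemma log_mean_exp_convex:
  assumes X: "\<And>\<theta>'. integrable M (\<lambda>z. exp (X \<theta>' z :: real))"
    and X': "\<And>\<theta>'. integrable M (\<lambda>z. exp (X' \<theta>' z :: real))"
    and Y: "\<And>\<theta>'. integrable M (\<lambda>z. exp (Y \<theta>' z :: real))"
    and t: "0 \<le> t" "t \<le> 1"
    and le: "\<And>\<theta>' z. z \<in> space M \<Longrightarrow> Y \<theta>' z \<le> (1 - t) * X \<theta>' z + t * X' \<theta>' z"
  shows "log_mean_exp \<theta> Y \<le> (1 - t) * log_mean_exp \<theta> X + t * log_mean_exp \<theta> X'"
proof -
  define L where "L = (1 - t) * log_mean_exp \<theta> X + t * log_mean_exp \<theta> X'"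
  have "mean \<theta> (\<lambda>\<theta>' z. exp (Y \<theta>' z - L)) \<le>
    mean \<theta> (\<lambda>\<theta>' z. (1 - t) * exp (X \<theta>' z - log_mean_exp \<theta> X)
      + t * exp (X' \<theta>' z - log_mean_exp \<theta> X'))"
  proof (rule mean_mono)
    fix \<theta>' z assume z: "z \<in> space M"
    have "exp (Y \<theta>' z - L) \<le>
      exp ((1 - t) *\<^sub>R (X \<theta>' z - log_mean_exp \<theta> X) + t *\<^sub>R (X' \<theta>' z - log_mean_exp \<theta> X'))"
      using le[OF z, of \<theta>'] by (simp add: L_def algebra_simps)
    also have "\<dots> \<le> (1 - t) * exp (X \<theta>' z - log_mean_exp \<theta> X)
      + t * exp (X' \<theta>' z - log_mean_exp \<theta> X')"
      using t by (intro convex_onD[OF exp_convex]) auto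
    finally show "exp (Y \<theta>' z - L) \<le> (1 - t) * exp (X \<theta>' z - log_mean_exp \<theta> X)
      + t * exp (X' \<theta>' z - log_mean_exp \<theta> X')" .
  qed (use X X' Y in \<open>simp_all add: exp_diff\<close>)
  then have "mean \<theta> (\<lambda>\<theta>' z. exp (Y \<theta>' z)) \<le> exp L"
    unfolding mean_exp_combination[OF X X'] mean_exp_diff by simp
  then have "log_mean_exp \<theta> Y \<le> L"
    unfolding log_mean_exp_def using mean_exp_pos[OF Y] ln_le_cancel_iff[of _ "exp L"] by simp
  then show ?thesis by (simp add: L_def)
qed

lemma log_mean_exp_mono:
  assumes "\<And>\<theta>'. integrable M (\<lambda>z. exp (X \<theta>' z :: real))"
    and "\<And>\<theta>'. integrable M (\<lambda>z. exp (Y \<theta>' z :: real))"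
    and "\<And>\<theta>' z. z \<in> space M \<Longrightarrow> Y \<theta>' z \<le> X \<theta>' z"
  shows "log_mean_exp \<theta> Y \<le> log_mean_exp \<theta> X"
  using log_mean_exp_convex[of X X Y 0 \<theta>] assms by simp

text \<open>After normalisation to mean one, the gap \<open>(exp (a \<theta>' z) + exp (b \<theta>'
  z)) / 2 - exp (c \<theta>' z)\<close> is non-negative with mean zero, so it vanishes almost
  everywhere. The strict inequality of the means then forces \<open>a\<close>, \<open>b\<close> and
  \<open>c\<close> to agree.\<close>

lemma log_mean_exp_midpoint_eq:
  assumes X: "\<And>\<theta>'. integrable M (\<lambda>z. exp (X \<theta>' z :: real))"
    and X': "\<And>\<theta>'. integrable M (\<lambda>z. exp (X' \<theta>' z :: real))"
    and Y: "\<And>\<theta>'. integrable M (\<lambda>z. exp (Y \<theta>' z :: real))"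
    and le: "\<And>\<theta>' z. z \<in> space M \<Longrightarrow> Y \<theta>' z \<le> (X \<theta>' z + X' \<theta>' z) / 2"
    and eq: "log_mean_exp \<theta> Y = (log_mean_exp \<theta> X + log_mean_exp \<theta> X') / 2"
    and p: "0 < p \<theta> \<theta>'"
  shows "AE z in M. X' \<theta>' z - X \<theta>' z = log_mean_exp \<theta> X' - log_mean_exp \<theta> X \<and>
    Y \<theta>' z = (X \<theta>' z + X' \<theta>' z) / 2"
proof -
  define a where "a \<theta>' z = X \<theta>' z - log_mean_exp \<theta> X" for \<theta>' z
  define b where "b \<theta>' z = X' \<theta>' z - log_mean_exp \<theta> X'" for \<theta>' z
  define c where "c \<theta>' z = Y \<theta>' z - log_mean_exp \<theta> Y" for \<theta>' z
  have c_le: "c \<theta>' z \<le> (a \<theta>' z + b \<theta>' z) / 2" if "z \<in> space M" for \<theta>' z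
    using le[OF that, of \<theta>'] eq by (simp add: a_def b_def c_def field_simps)
  have mid: "exp ((a \<theta>' z + b \<theta>' z) / 2) \<le> (exp (a \<theta>' z) + exp (b \<theta>' z)) / 2" for \<theta>' z
    using exp_mid_less[of "a \<theta>' z" "b \<theta>' z"] by (cases "a \<theta>' z = b \<theta>' z") auto
  have int: "integrable M (\<lambda>z. exp (a \<theta>' z))" "integrable M (\<lambda>z. exp (b \<theta>' z))"
    "integrable M (\<lambda>z. exp (c \<theta>' z))" for \<theta>'
    using X X' Y by (simp_all add: a_def b_def c_def exp_diff)
  have "mean \<theta> (\<lambda>\<theta>' z. (exp (a \<theta>' z) + exp (b \<theta>' z)) / 2 - exp (c \<theta>' z)) = 1 - 1"
    using int mean_exp_combination[OF X X', of \<theta> "1/2"] mean_exp_diff_log_mean_exp[OF Y, of \<theta>]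
    by (subst mean_diff) (simp_all add: a_def b_def c_def add_divide_distrib)
  then have "AE z in M. (exp (a \<theta>' z) + exp (b \<theta>' z)) / 2 - exp (c \<theta>' z) = 0"
  proof (intro AE_eq_0_if_mean_eq_0[where \<theta> = \<theta>] p)
    fix \<theta>' z assume z: "z \<in> space M"
    have "exp (c \<theta>' z) \<le> exp ((a \<theta>' z + b \<theta>' z) / 2)" using c_le[OF z] by simp
    then show "0 \<le> (exp (a \<theta>' z) + exp (b \<theta>' z)) / 2 - exp (c \<theta>' z)"
      using mid[of \<theta>' z] by linarith
  qed (use int in auto)
  then show ?thesis
  proof (rule AE_mp, intro AE_I2 impI)
    fix z assume z: "z \<in> space M" and 0: "(exp (a \<theta>' z) + exp (b \<theta>' z)) / 2 - exp (c \<theta>' z) = 0"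
    have exp_c: "exp (c \<theta>' z) \<le> exp ((a \<theta>' z + b \<theta>' z) / 2)" using c_le[OF z] by simp
    then have ab: "a \<theta>' z = b \<theta>' z" using exp_mid_less[of "a \<theta>' z" "b \<theta>' z"] 0 by fastforce
    then have "c \<theta>' z = a \<theta>' z" using 0 by simp
    then show "X' \<theta>' z - X \<theta>' z = log_mean_exp \<theta> X' - log_mean_exp \<theta> X \<and>
        Y \<theta>' z = (X \<theta>' z + X' \<theta>' z) / 2"
      using ab eq by (simp add: a_def b_def c_def field_simps)
  qed
qed

end

section \<open>Differentiation under the integral\<close>

text \<open>Dominated convergence along sequences tending to \<open>y\<close>: \<open>B\<close>
  dominates the difference quotients based at \<open>y\<close>, and \<open>F'\<close> is integrable
  as their limit.\<close>

lemma has_real_derivative_integral: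
  fixes F :: "real \<Rightarrow> 'a \<Rightarrow> real"
  assumes S: "open S" "y \<in> S"
    and int: "\<And>t. t \<in> S \<Longrightarrow> integrable M (F t)"
    and deriv: "\<And>z. z \<in> space M \<Longrightarrow> ((\<lambda>t. F t z) has_real_derivative F' z) (at y)"
    and bound: "\<And>t z. t \<in> S \<Longrightarrow> z \<in> space M \<Longrightarrow> \<bar>F t z - F y z\<bar> \<le> \<bar>t - y\<bar> * B z"
    and B: "integrable M B"
  shows "integrable M F'" and "((\<lambda>t. \<integral>z. F t z \<partial>M) has_real_derivative (\<integral>z. F' z \<partial>M)) (at y)"
proof -
  have *: "integrable M F' \<and>
      (\<lambda>n. ((\<integral>z. F (X n) z \<partial>M) - (\<integral>z. F y z \<partial>M)) / (X n - y)) \<longlonglongrightarrow> (\<integral>z. F' z \<partial>M)"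
    if X: "\<And>n. X n \<in> S" "\<And>n. X n \<noteq> y" "X \<longlonglongrightarrow> y" for X :: "nat \<Rightarrow> real"
  proof -
    let ?q = "\<lambda>n z. (F (X n) z - F y z) / (X n - y)"
    have lim: "(\<lambda>n. ?q n z) \<longlonglongrightarrow> F' z" if "z \<in> space M" for z
    proof -
      have "filterlim X (at y) sequentially"
        using X by (auto simp: filterlim_at)
      then show ?thesis
        using deriv[OF that] unfolding has_field_derivative_iff by (rule filterlim_compose[rotated])
    qed
    have meas: "?q n \<in> borel_measurable M" for n
      using int[OF X(1)] int[OF S(2)] by auto
    have F'_meas: "F' \<in> borel_measurable M"
      by (rule borel_measurable_LIMSEQ_real[OF lim meas])
    have q_le: "AE z in M. norm (?q n z) \<le> B z" for n
      using bound[OF X(1)] X(2) by (auto simp: divide_le_eq mult.commute)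
    have AE_lim: "AE z in M. (\<lambda>n. ?q n z) \<longlonglongrightarrow> F' z" using lim by auto
    have "(\<lambda>n. \<integral>z. ?q n z \<partial>M) = (\<lambda>n. ((\<integral>z. F (X n) z \<partial>M) - (\<integral>z. F y z \<partial>M)) / (X n - y))"
      using int[OF X(1)] int[OF S(2)] by (intro ext) simp
    then show ?thesis
      using integrable_dominated_convergence[OF F'_meas meas B AE_lim q_le]
        integral_dominated_convergence[OF F'_meas meas B AE_lim q_le] by metis
  qed
  obtain e where e: "0 < e" "ball y e \<subseteq> S" using S openE by blast
  \<comment> \<open>One concrete sequence in \<open>S\<close> avoiding \<open>y\<close> suffices for
    integrability of \<open>F'\<close>. With \<open>Suc (Suc n)\<close> even the first step is
    shorter than \<open>e\<close>.\<close>
  have "(\<lambda>n. y + e / real (Suc (Suc n))) \<longlonglongrightarrow> y" by real_asymp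
  moreover have "y + e / real (Suc (Suc n)) \<in> S" for n
  proof -
    have "e / real (Suc (Suc n)) < e" using e by (simp add: divide_less_eq)
    then show ?thesis using e by (intro subsetD[OF e(2)]) (simp add: dist_real_def)
  qed
  ultimately show "integrable M F'"
    using *[of "\<lambda>n. y + e / real (Suc (Suc n))"] e(1) by auto
  show "((\<lambda>t. \<integral>z. F t z \<partial>M) has_real_derivative (\<integral>z. F' z \<partial>M)) (at y)"
    unfolding has_field_derivative_iff tendsto_at_iff_sequentially comp_def
  proof (intro allI impI)
    fix X assume X: "\<forall>n. X n \<in> UNIV - {y}" "X \<longlonglongrightarrow> y"
    \<comment> \<open>An arbitrary sequence lies in \<open>S\<close> only eventually, so its first
      \<open>N\<close> terms are dropped.\<close>
    then obtain N where N: "\<And>n. n \<ge> N \<Longrightarrow> X n \<in> S"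
      using topological_tendstoD[OF X(2) S] unfolding eventually_sequentially by blast
    show "(\<lambda>n. ((\<integral>z. F (X n) z \<partial>M) - (\<integral>z. F y z \<partial>M)) / (X n - y)) \<longlonglongrightarrow> (\<integral>z. F' z \<partial>M)"
    proof (rule LIMSEQ_offset[where k = N])
      have "(\<lambda>n. X (n + N)) \<longlonglongrightarrow> y" using X(2) by (rule LIMSEQ_ignore_initial_segment)
      moreover have "X (n + N) \<in> S" "X (n + N) \<noteq> y" for n using N[of "n + N"] X(1) by simp_all
      ultimately show "(\<lambda>n. ((\<integral>z. F (X (n + N)) z \<partial>M) - (\<integral>z. F y z \<partial>M)) / (X (n + N) - y))
          \<longlonglongrightarrow> (\<integral>z. F' z \<partial>M)"
        by (intro *[THEN conjunct2])
    qed
  qed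
qed

section \<open>The growth model\<close>

text \<open>The hypotheses in pointwise form, with \<open>K\<close> bounding \<open>V\<close>
  relative to the weight. \<open>growth\<close> is strict, so that some shock of the next period has
  a weight strictly below the bound.\<close>

locale growth_model = markov_shock \<nu> p
  for \<nu> :: "real measure" and p :: "'s::finite \<Rightarrow> 's \<Rightarrow> real" +
  fixes \<beta> \<gamma> \<alpha> K :: real
    and u :: "real \<Rightarrow> real"
    and f :: "'s \<Rightarrow> real \<Rightarrow> real \<Rightarrow> real"
    and w V \<phi> :: "real \<Rightarrow> 's \<Rightarrow> real"
  assumes sets_\<nu>: "sets \<nu> = sets (restrict_space borel {0..})"
    and \<beta>: "0 < \<beta>" "\<beta> < 1"
    and \<gamma>: "0 < \<gamma>"
    and f_nonneg: "0 \<le> y \<Longrightarrow> 0 \<le> z \<Longrightarrow> 0 \<le> f \<theta> y z"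
    and w_ge_1: "0 \<le> x \<Longrightarrow> 1 \<le> w x \<theta>"
    and w_cont: "continuous_on {0..} (\<lambda>x. w x \<theta>)"
    and w_mono: "mono_on {0..} (\<lambda>x. w x \<theta>)"
    and u_nonneg: "0 \<le> c \<Longrightarrow> 0 \<le> u c"
    and u_strictly_concave: "strictly_concave_on {0..} u"
    and u_strict_mono: "strict_mono_on {0..} u"
    and u_0: "u 0 = 0"
    and u_deriv: "0 < c \<Longrightarrow> (u has_real_derivative deriv u c) (at c)"
    and u_Inada: "filterlim (\<lambda>h. u h / h) at_top (at_right 0)"
    and f_mono: "0 \<le> z \<Longrightarrow> mono_on {0..} (\<lambda>y. f \<theta> y z)"
    and f_concave: "0 \<le> z \<Longrightarrow> concave_on {0..} (\<lambda>y. f \<theta> y z)"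
    and f_borel: "0 \<le> y \<Longrightarrow> (\<lambda>z. f \<theta> y z) \<in> borel_measurable (restrict_space borel {0..})"
    and growth: "0 \<le> y \<Longrightarrow> (\<integral>\<^sup>+z. ennreal (w (f \<theta> y z) \<theta>') \<partial>\<nu>) < ennreal (\<alpha> * w y \<theta>)"
    and \<alpha>: "0 < \<alpha>" "\<alpha> * \<beta> < 1"
    and f_deriv: "0 \<le> z \<Longrightarrow> 0 < y \<Longrightarrow> ((\<lambda>y. f \<theta> y z) has_real_derivative prod_deriv f \<theta> y z) (at y)"
    and f_0: "0 \<le> z \<Longrightarrow> f \<theta> 0 z = 0"
    and f_deriv_pos: "AE z in \<nu>. \<exists>y>0. \<forall>\<theta>. prod_deriv f \<theta> y z > 0"
    and V_mono: "mono_on {0..} (\<lambda>x. V x \<theta>)"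
    and V_nonneg: "0 \<le> x \<Longrightarrow> 0 \<le> V x \<theta>"
    and V_cont: "continuous_on {0..} (\<lambda>x. V x \<theta>)"
    and V_concave: "concave_on {0..} (\<lambda>x. V x \<theta>)"
    and V_le: "0 \<le> x \<Longrightarrow> V x \<theta> \<le> K * w x \<theta>"
    and bellman: "0 \<le> x \<Longrightarrow> V x \<theta> = (SUP y\<in>{0..x}. bellman_objective p \<nu> \<beta> \<gamma> u f V x \<theta> y)"
    and \<phi>_bounds: "0 \<le> x \<Longrightarrow> 0 \<le> \<phi> x \<theta>" "0 \<le> x \<Longrightarrow> \<phi> x \<theta> \<le> x"
    and optimal: "0 \<le> x \<Longrightarrow> bellman_objective p \<nu> \<beta> \<gamma> u f V x \<theta> (\<phi> x \<theta>) =
        (SUP y\<in>{0..x}. bellman_objective p \<nu> \<beta> \<gamma> u f V x \<theta> y)"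
begin

section \<open>Functions of next-period income\<close>

lemma space_\<nu>: "space \<nu> = {0..}"
  using sets_eq_imp_space_eq[OF sets_\<nu>] by (simp add: space_restrict_space)

lemma f_measurable: "0 \<le> y \<Longrightarrow> f \<theta> y \<in> borel_measurable \<nu>"
  using f_borel measurable_cong_sets[OF sets_\<nu> refl] by blast

text \<open>Continuity of \<open>g\<close> is known on the half-line only. The extension
  \<open>g (max 0 x)\<close> is continuous everywhere and agrees with \<open>g\<close> at the values
  of \<open>f\<close>.\<close>

lemma compose_f_measurable:
  fixes g :: "real \<Rightarrow> real"
  assumes "continuous_on {0..} g" "0 \<le> y"
  shows "(\<lambda>z. g (f \<theta> y z)) \<in> borel_measurable \<nu>"
proof -
  have "continuous_on UNIV (\<lambda>x. g (max 0 x))"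
    by (rule continuous_on_compose2[OF assms(1)]) (auto intro: continuous_on_max)
  then have "(\<lambda>z. g (max 0 (f \<theta> y z))) \<in> borel_measurable \<nu>"
    by (intro measurable_compose[OF f_measurable[OF assms(2)]] borel_measurable_continuous_onI)
  then show ?thesis
    using f_nonneg[OF assms(2)] by (subst measurable_cong) (auto simp: space_\<nu> max_def)
qed

lemma V_f_mono:
  assumes "0 \<le> z" shows "mono_on {0..} (\<lambda>y. V (f \<theta> y z) \<theta>')"
proof (rule monotone_onI)
  fix y y' :: real assume y: "y \<in> {0..}" "y' \<in> {0..}" "y \<le> y'"
  then have "f \<theta> y z \<le> f \<theta> y' z" using monotone_onD[OF f_mono[OF assms]] by blast
  then show "V (f \<theta> y z) \<theta>' \<le> V (f \<theta> y' z) \<theta>'"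
    using monotone_onD[OF V_mono, of "f \<theta> y z" "f \<theta> y' z" \<theta>'] f_nonneg y assms by simp
qed

lemma V_f_concave:
  assumes z: "0 \<le> z" shows "concave_on {0..} (\<lambda>y. V (f \<theta> y z) \<theta>')"
  unfolding concave_on_iff
proof (intro conjI ballI allI impI)
  fix x y s t :: real
  assume *: "x \<in> {0..}" "y \<in> {0..}" "0 \<le> s" "0 \<le> t" "s + t = 1"
  then have "s * V (f \<theta> x z) \<theta>' + t * V (f \<theta> y z) \<theta>'
      \<le> V (s *\<^sub>R f \<theta> x z + t *\<^sub>R f \<theta> y z) \<theta>'"
    using V_concave[of \<theta>'] f_nonneg z unfolding concave_on_iff by auto
  also have "\<dots> \<le> V (f \<theta> (s *\<^sub>R x + t *\<^sub>R y) z) \<theta>'"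
  proof (intro monotone_onD[OF V_mono])
    show "s *\<^sub>R f \<theta> x z + t *\<^sub>R f \<theta> y z \<le> f \<theta> (s *\<^sub>R x + t *\<^sub>R y) z"
      using f_concave[OF z, of \<theta>] * unfolding concave_on_iff by auto
  qed (use * z f_nonneg in auto)
  finally show "s * V (f \<theta> x z) \<theta>' + t * V (f \<theta> y z) \<theta>' \<le> V (f \<theta> (s *\<^sub>R x + t *\<^sub>R y) z) \<theta>'" .
qed simp

text \<open>The tangent at a point \<open>y0\<close> of positive slope, evaluated at
  \<open>0\<close> where \<open>f\<close> vanishes, makes \<open>f \<theta> y0 z\<close> positive.
  Scaling carries this to smaller \<open>y\<close>, monotonicity to larger \<open>y\<close>.\<close>

lemma f_pos: "AE z in \<nu>. \<forall>\<theta>. \<forall>y>0. 0 < f \<theta> y z"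
  using f_deriv_pos
proof (rule AE_mp, intro AE_I2 impI allI)
  fix z y \<theta> assume "z \<in> space \<nu>" and "\<exists>y>0. \<forall>\<theta>. prod_deriv f \<theta> y z > 0" and y: "0 < (y::real)"
  then obtain y0 where z: "0 \<le> z" and y0: "0 < y0" "prod_deriv f \<theta> y0 z > 0"
    by (auto simp: space_\<nu>)
  have "f \<theta> 0 z \<le> f \<theta> y0 z + prod_deriv f \<theta> y0 z * (0 - y0)"
    using y0 z by (intro concave_on_below_tangent f_concave f_deriv) auto
  then have pos: "0 < f \<theta> y0 z"
    using f_0[OF z, of \<theta>] mult_pos_pos[OF y0(2,1)] by (simp only: diff_0 mult_minus_right)
  show "0 < f \<theta> y z"
  proof (cases "y \<le> y0")
    case True
    have "0 < y * f \<theta> y0 z" using y pos by simp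
    also have "\<dots> \<le> y0 * f \<theta> y z"
      using True y f_0[OF z] by (intro concave_on_scale f_concave z) auto
    finally show ?thesis using y0 by (simp add: zero_less_mult_iff)
  next
    case False
    then show ?thesis using monotone_onD[OF f_mono[OF z], of y0 y \<theta>] y0 pos by simp
  qed
qed

lemma f_eq_0:
  assumes z: "0 \<le> z" and y: "0 < y" and 0: "f \<theta> y z = 0" and t: "0 \<le> t"
  shows "f \<theta> t z = 0"
proof (cases "t \<le> y")
  case True
  then show ?thesis using monotone_onD[OF f_mono[OF z], of t y \<theta>] f_nonneg[OF t z, of \<theta>] t y 0 by simp
next
  case False
  then have "y * f \<theta> t z \<le> t * f \<theta> y z"
    using y f_0[OF z] by (intro concave_on_scale f_concave z) auto
  then show ?thesis using y 0 f_nonneg[OF t z, of \<theta>] by (simp add: mult_le_0_iff)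
qed

section \<open>The continuation value\<close>

definition log_weight :: "'s \<Rightarrow> real \<Rightarrow> 's \<Rightarrow> real \<Rightarrow> real" where
  "log_weight \<theta> y \<theta>' z = - \<gamma> * V (f \<theta> y z) \<theta>'"

text \<open>This is \<beta> times the entropic certainty equivalent, with risk parameter \<gamma>,
  of the value in the next period.\<close>

definition continuation :: "'s \<Rightarrow> real \<Rightarrow> real" where
  "continuation \<theta> y = - (\<beta> / \<gamma>) * log_mean_exp \<theta> (log_weight \<theta> y)"

lemma bellman_objective_eq:
  "bellman_objective p \<nu> \<beta> \<gamma> u f V x \<theta> y = u (x - y) + continuation \<theta> y"
  by (simp add: bellman_objective_def continuation_def log_mean_exp_def mean_def log_weight_def)

lemma log_weight_nonpos: "0 \<le> y \<Longrightarrow> 0 \<le> z \<Longrightarrow> log_weight \<theta> y \<theta>' z \<le> 0"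
  using \<gamma> V_nonneg f_nonneg by (simp add: log_weight_def)

lemma integrable_exp_log_weight:
  assumes "0 \<le> y"
  shows "integrable \<nu> (\<lambda>z. exp (log_weight \<theta> y \<theta>' z))"
proof (rule integrable_const_bound[where B = 1])
  show "AE z in \<nu>. norm (exp (log_weight \<theta> y \<theta>' z)) \<le> 1"
    using log_weight_nonpos[OF assms] by (auto simp: space_\<nu>)
  show "(\<lambda>z. exp (log_weight \<theta> y \<theta>' z)) \<in> borel_measurable \<nu>"
    using compose_f_measurable[OF V_cont assms, of \<theta> \<theta>'] by (auto simp: log_weight_def)
qed

lemma log_mean_exp_le_iff_continuation:
  "continuation \<theta> y \<le> continuation \<theta> y' \<longleftrightarrow>
    log_mean_exp \<theta> (log_weight \<theta> y') \<le> log_mean_exp \<theta> (log_weight \<theta> y)"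
  using \<beta> \<gamma> by (simp add: continuation_def divide_le_cancel)

lemma continuation_mono: "mono_on {0..} (continuation \<theta>)"
proof (intro monotone_onI)
  fix y y' :: real assume y: "y \<in> {0..}" "y' \<in> {0..}" "y \<le> y'"
  have "log_mean_exp \<theta> (log_weight \<theta> y') \<le> log_mean_exp \<theta> (log_weight \<theta> y)"
  proof (intro log_mean_exp_mono)
    fix \<theta>' z assume "z \<in> space \<nu>"
    then have "V (f \<theta> y z) \<theta>' \<le> V (f \<theta> y' z) \<theta>'"
      using y by (intro monotone_onD[OF V_f_mono]) (auto simp: space_\<nu>)
    then show "log_weight \<theta> y' \<theta>' z \<le> log_weight \<theta> y \<theta>' z" using \<gamma> by (simp add: log_weight_def)
  qed (use y integrable_exp_log_weight in auto)
  then show "continuation \<theta> y \<le> continuation \<theta> y'" by (simp add: log_mean_exp_le_iff_continuation)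
qed

lemma log_weight_convex:
  assumes z: "z \<in> space \<nu>" and y: "0 \<le> y" "0 \<le> y'" and t: "0 \<le> t" "t \<le> 1"
  shows "log_weight \<theta> ((1 - t) * y + t * y') \<theta>' z
    \<le> (1 - t) * log_weight \<theta> y \<theta>' z + t * log_weight \<theta> y' \<theta>' z"
proof -
  have "(1 - t) * V (f \<theta> y z) \<theta>' + t * V (f \<theta> y' z) \<theta>'
      \<le> V (f \<theta> ((1 - t) *\<^sub>R y + t *\<^sub>R y') z) \<theta>'"
    using z y t by (intro concave_onD[OF V_f_concave]) (auto simp: space_\<nu>)
  from mult_left_mono[OF this, of \<gamma>] \<gamma> show ?thesis by (simp add: log_weight_def algebra_simps)
qed

lemma continuation_concave: "concave_on {0..} (continuation \<theta>)"
  unfolding concave_on_def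
proof (intro convex_onI)
  fix t y y' :: real assume t: "0 < t" "t < 1" and y: "y \<in> {0..}" "y' \<in> {0..}"
  have "0 \<le> (1 - t) * y + t * y'" using t y by simp
  then have "log_mean_exp \<theta> (log_weight \<theta> ((1 - t) * y + t * y')) \<le>
    (1 - t) * log_mean_exp \<theta> (log_weight \<theta> y) + t * log_mean_exp \<theta> (log_weight \<theta> y')"
    using y t by (intro log_mean_exp_convex log_weight_convex integrable_exp_log_weight) auto
  from mult_left_mono[OF this, of "\<beta> / \<gamma>"] \<beta> \<gamma>
  show "- continuation \<theta> ((1 - t) *\<^sub>R y + t *\<^sub>R y') \<le> (1 - t) * - continuation \<theta> y + t * - continuation \<theta> y'"
    by (simp add: continuation_def algebra_simps diff_divide_distrib)
qed simp

section \<open>First consequences of the Bellman equation\<close>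

lemma u_mono: "0 \<le> c \<Longrightarrow> c \<le> c' \<Longrightarrow> u c \<le> u c'"
  using strict_mono_onD[OF u_strict_mono, of c c'] by (cases "c = c'") auto

lemma u_concave: "concave_on {0..} u"
  using u_strictly_concave by (rule strictly_concave_on_imp_concave_on)

lemma V_eq: "0 \<le> x \<Longrightarrow> V x \<theta> = u (x - \<phi> x \<theta>) + continuation \<theta> (\<phi> x \<theta>)"
  using bellman optimal by (simp add: bellman_objective_eq)

lemma V_ge:
  assumes "0 \<le> y" "y \<le> x"
  shows "u (x - y) + continuation \<theta> y \<le> V x \<theta>"
proof -
  \<comment> \<open>A real supremum is an upper bound only of a bounded set. Both terms are largest
    when all of \<open>x\<close> goes to them.\<close>
  have "bdd_above ((\<lambda>y. u (x - y) + continuation \<theta> y) ` {0..x})"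
  proof (rule bdd_aboveI2)
    fix t assume "t \<in> {0..x}"
    then show "u (x - t) + continuation \<theta> t \<le> u x + continuation \<theta> x"
      using u_mono[of "x - t" x] monotone_onD[OF continuation_mono, of t x \<theta>] by simp
  qed
  then show ?thesis
    using assms bellman[of x \<theta>] by (auto simp: bellman_objective_eq intro: cSUP_upper)
qed

text \<open>Income zero stays zero, so in the regime where \<open>V 0\<close> has its maximum
  \<open>m\<close> the Bellman equation gives \<open>m \<le> \<beta> * m\<close>.\<close>

lemma V_0: "V 0 \<theta> = 0"
proof -
  define m where "m = Max (range (V 0))"
  have m: "V 0 \<theta> \<le> m" for \<theta> by (simp add: m_def)
  have "m \<in> range (V 0)" unfolding m_def by (rule Max_in) auto
  then obtain \<theta>1 where \<theta>1: "m = V 0 \<theta>1" by auto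
  have "log_mean_exp \<theta>1 (\<lambda>_ _. - \<gamma> * m) \<le> log_mean_exp \<theta>1 (log_weight \<theta>1 0)"
    using m \<gamma> f_0 by (intro log_mean_exp_mono integrable_exp_log_weight) (auto simp: log_weight_def space_\<nu>)
  then have "- \<gamma> * m \<le> log_mean_exp \<theta>1 (log_weight \<theta>1 0)" by (simp add: log_mean_exp_def)
  from mult_left_mono[OF this, of "\<beta> / \<gamma>"] \<beta> \<gamma>
  have "continuation \<theta>1 0 \<le> \<beta> * m" by (simp add: continuation_def)
  moreover have "V 0 \<theta>1 = continuation \<theta>1 0"
    using V_eq[of 0 \<theta>1] \<phi>_bounds[of 0 \<theta>1] u_0 by simp
  ultimately have "(1 - \<beta>) * m \<le> 0" using \<theta>1 by (simp add: algebra_simps)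
  then have "m \<le> 0" using \<beta> by (simp add: mult_le_0_iff)
  then show ?thesis using m[of \<theta>] V_nonneg[of 0 \<theta>] by simp
qed

lemma continuation_0: "continuation \<theta> 0 = 0"
proof -
  have "mean \<theta> (\<lambda>\<theta>' z. exp (log_weight \<theta> 0 \<theta>' z)) = mean \<theta> (\<lambda>_ _. 1)"
    by (intro mean_cong) (simp add: log_weight_def f_0 V_0 space_\<nu>)
  then show ?thesis by (simp add: continuation_def log_mean_exp_def)
qed

lemma u_le_V: "0 \<le> x \<Longrightarrow> u x \<le> V x \<theta>"
  using V_ge[of 0 x \<theta>] by (simp add: continuation_0)

text \<open>At the higher income, keep the investment \<open>\<phi> x \<theta>\<close> and consume
  the excess.\<close>

lemma V_strict_mono:
  assumes "0 \<le> x" "x < x'"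
  shows "V x \<theta> < V x' \<theta>"
proof -
  have "V x \<theta> = u (x - \<phi> x \<theta>) + continuation \<theta> (\<phi> x \<theta>)" by (rule V_eq[OF assms(1)])
  also have "\<dots> < u (x' - \<phi> x \<theta>) + continuation \<theta> (\<phi> x \<theta>)"
    using \<phi>_bounds[OF assms(1), of \<theta>] assms
    by (intro add_strict_right_mono strict_mono_onD[OF u_strict_mono]) auto
  also have "\<dots> \<le> V x' \<theta>"
    using \<phi>_bounds[OF assms(1), of \<theta>] assms by (intro V_ge) auto
  finally show ?thesis .
qed

section \<open>Interiority of the optimal investment\<close>

lemma u_quotient_unbounded:
  assumes "0 < e"
  obtains h where "0 < h" "h < e" "C * h < u h"
proof -
  have "eventually (\<lambda>h. C < u h / h) (at_right 0)"
    using u_Inada by (simp add: filterlim_at_top_dense)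
  moreover have "eventually (\<lambda>h. h \<in> {0<..<e}) (at_right 0)"
    using assms by (rule eventually_at_right_real)
  ultimately have "eventually (\<lambda>h. 0 < h \<and> h < e \<and> C * h < u h) (at_right 0)"
    by eventually_elim (auto simp: less_divide_eq)
  then show thesis using that eventually_happens[of _ "at_right (0::real)"] by auto
qed

text \<open>If all income were invested, moving a small \<open>h\<close> to consumption would gain
  \<open>u h\<close>, more than \<open>C * h\<close>, and cost at most \<open>C * h\<close>. Here
  \<open>C\<close> is the Lipschitz constant of the continuation value beyond \<open>x / 2\<close>,
  whence \<open>h < x / 2\<close>.\<close>

lemma \<phi>_less:
  assumes x: "0 < x"
  shows "\<phi> x \<theta> < x"
proof (rule ccontr)
  assume "\<not> \<phi> x \<theta> < x"
  then have "\<phi> x \<theta> = x" using \<phi>_bounds[of x \<theta>] x by simp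
  then have V: "V x \<theta> = continuation \<theta> x" using V_eq[of x \<theta>] x u_0 by simp
  define C where "C = continuation \<theta> (x / 2) / (x / 2)"
  obtain h where h: "0 < h" "h < x / 2" "C * h < u h"
    using u_quotient_unbounded[of "x / 2" C] x by auto
  have "u h + continuation \<theta> (x - h) \<le> continuation \<theta> x"
    using V_ge[of "x - h" x \<theta>] h x V by simp
  moreover have "\<bar>continuation \<theta> x - continuation \<theta> (x - h)\<bar> \<le> \<bar>x - (x - h)\<bar> * C"
    unfolding C_def using x h
    by (intro concave_on_lipschitz_away_from_0 continuation_concave continuation_mono)
      (auto simp: continuation_0)
  ultimately show False using h by (simp add: mult.commute)
qed

text \<open>
  Since \<open>V \<ge> u\<close> and \<open>f \<theta> 1 z\<close> is bounded away from \<open>0\<close> with positive probability,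
  the continuation value inherits the infinite slope of \<open>u\<close> at \<open>0\<close>.
\<close>

lemma continuation_lower_bound:
  obtains a c where "0 < a" "0 < c" "\<And>y. 0 \<le> y \<Longrightarrow> y \<le> 1 \<Longrightarrow> c * u (y * a) \<le> continuation \<theta> y"
proof -
  \<comment> \<open>Otherwise \<open>f \<theta> 1 z\<close> would almost surely be below every
    \<open>1 / (n + 1)\<close>, against its positivity.\<close>
  have "\<exists>n. \<not> (AE z in \<nu>. f \<theta> 1 z < inverse (real (Suc n)))"
  proof (rule ccontr)
    assume "\<not> (\<exists>n. \<not> (AE z in \<nu>. f \<theta> 1 z < inverse (real (Suc n))))"
    then have "AE z in \<nu>. \<forall>n. f \<theta> 1 z < inverse (real (Suc n))"
      by (simp add: AE_all_countable)
    with f_pos have "AE z in \<nu>. False"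
    proof eventually_elim
      case (elim z)
      then have "0 < f \<theta> 1 z" by simp
      then obtain n where "inverse (real (Suc n)) < f \<theta> 1 z" using reals_Archimedean by blast
      with elim show False by (meson less_asym)
    qed
    then show False by simp
  qed
  then obtain n where n: "\<not> (AE z in \<nu>. f \<theta> 1 z < inverse (real (Suc n)))" ..
  define a where "a = inverse (real (Suc n))"
  have a: "0 < a" by (simp add: a_def)
  define A where "A = {z \<in> space \<nu>. a \<le> f \<theta> 1 z}"
  have A[measurable]: "A \<in> sets \<nu>"
    unfolding A_def using f_measurable[of 1 \<theta>] by measurable
  have "prob A \<noteq> 0"
  proof
    assume "prob A = 0"
    then have "AE z in \<nu>. z \<notin> A" using prob_eq_0[OF A] by simp
    then have "AE z in \<nu>. f \<theta> 1 z < a" by (rule AE_mp) (auto simp: A_def)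
    then show False using n by (simp add: a_def)
  qed
  then have A_int: "integrable \<nu> (\<lambda>z. indicator A z :: real)" and A_pos: "0 < prob A"
    using A by (simp_all add: less_le integrable_real_indicator less_top[symmetric])
  \<comment> \<open>The final estimate is
    \<open>\<beta> / \<gamma> * (v / (1 + \<gamma> * u a) * prob A)\<close> with
    \<open>v = \<gamma> * u (y * a)\<close>; \<open>c\<close> is its coefficient of
    \<open>u (y * a)\<close>.\<close>
  define c where "c = \<beta> * prob A / (1 + \<gamma> * u a)"
  have ua: "0 < 1 + \<gamma> * u a" using u_nonneg[of a] a \<gamma> by (simp add: add_pos_nonneg)
  show thesis
  proof (rule that[OF a])
    show "0 < c" using \<beta> A_pos ua by (simp add: c_def)
    fix y :: real assume y: "0 \<le> y" "y \<le> 1"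
    define v where "v = \<gamma> * u (y * a)"
    have v: "0 \<le> v" "v \<le> \<gamma> * u a"
      using \<gamma> u_nonneg[of "y * a"] u_mono[of "y * a" a] y a mult_right_mono[of y 1 a]
      by (auto simp: v_def)
    have f_ge: "y * a \<le> f \<theta> y z" if "z \<in> A" for z
    proof (cases "y = 0")
      case False
      have z: "0 \<le> z" "a \<le> f \<theta> 1 z" using that by (auto simp: A_def space_\<nu>)
      have "y * f \<theta> 1 z \<le> 1 * f \<theta> y z"
        using False y f_0[OF z(1)] by (intro concave_on_scale f_concave z) auto
      then show ?thesis using mult_left_mono[OF z(2) y(1)] by simp
    qed (use that f_0 in \<open>auto simp: A_def space_\<nu>\<close>)
    \<comment> \<open>On \<open>A\<close> the next income is at least \<open>y * a\<close>, which
      bounds the exponential by \<open>exp (- v)\<close>; off \<open>A\<close> it is at most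
      \<open>1\<close>.\<close>
    have weight_le: "exp (log_weight \<theta> y \<theta>' z) \<le> 1 - (1 - exp (- v)) * indicator A z"
      if z: "z \<in> space \<nu>" for \<theta>' z
    proof (cases "z \<in> A")
      case True
      have "u (y * a) \<le> V (y * a) \<theta>'" using y a by (intro u_le_V) auto
      also have "\<dots> \<le> V (f \<theta> y z) \<theta>'"
        using f_ge[OF True] y a z f_nonneg by (intro monotone_onD[OF V_mono]) (auto simp: space_\<nu>)
      finally show ?thesis using True \<gamma> by (simp add: log_weight_def v_def)
    next
      case False
      then show ?thesis using log_weight_nonpos[OF y(1), of z \<theta> \<theta>'] z by (simp add: space_\<nu>)
    qed
    have "mean \<theta> (\<lambda>\<theta>' z. exp (log_weight \<theta> y \<theta>' z)) \<le> mean \<theta> (\<lambda>\<theta>' z. 1 - (1 - exp (- v)) * indicator A z)"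
      using weight_le A_int by (intro mean_mono integrable_exp_log_weight y) auto
    also have "\<dots> = 1 - (1 - exp (- v)) * prob A"
      using A_int by (simp add: mean_def sum_p prob_space flip: sum_distrib_right)
    finally have "log_mean_exp \<theta> (log_weight \<theta> y) \<le> - ((1 - exp (- v)) * prob A)"
      unfolding log_mean_exp_def
      using ln_le_minus_one[OF mean_exp_pos, of "log_weight \<theta> y" \<theta>] integrable_exp_log_weight[OF y(1)]
      by fastforce
    from mult_left_mono[OF this, of "\<beta> / \<gamma>"] \<beta> \<gamma>
    have cont: "\<beta> / \<gamma> * ((1 - exp (- v)) * prob A) \<le> continuation \<theta> y"
      by (simp add: continuation_def)
    \<comment> \<open>This yields \<open>1 - exp (- v) \<ge> v / (1 + v)\<close>; then
      \<open>v \<le> \<gamma> * u a\<close> makes the denominator independent of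
      \<open>y\<close>.\<close>
    have "1 + v \<le> exp v" by (rule exp_ge_add_one_self)
    then have "exp (- v) \<le> 1 / (1 + v)" using v by (simp add: exp_minus field_simps)
    then have "v / (1 + v) \<le> 1 - exp (- v)" using v by (simp add: field_simps)
    moreover have "v / (1 + \<gamma> * u a) \<le> v / (1 + v)" using v by (intro divide_left_mono) auto
    ultimately have "v / (1 + \<gamma> * u a) \<le> 1 - exp (- v)" by simp
    then have "\<beta> / \<gamma> * (v / (1 + \<gamma> * u a) * prob A) \<le> \<beta> / \<gamma> * ((1 - exp (- v)) * prob A)"
      using \<beta> \<gamma> by (intro mult_left_mono mult_right_mono) auto
    moreover have "\<beta> / \<gamma> * (v / (1 + \<gamma> * u a) * prob A) = c * u (y * a)"
      using \<gamma> by (simp add: c_def v_def)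
    ultimately show "c * u (y * a) \<le> continuation \<theta> y" using cont by simp
  qed
qed

text \<open>The mirror image of \<open>\<phi>_less\<close>: starting from zero investment, investing
  \<open>y\<close> costs at most \<open>y * C\<close> of utility and gains at least
  \<open>c * u (y * a)\<close>, whose slope at \<open>0\<close> is infinite.\<close>

lemma \<phi>_pos:
  assumes x: "0 < x"
  shows "0 < \<phi> x \<theta>"
proof (rule ccontr)
  assume "\<not> 0 < \<phi> x \<theta>"
  then have "\<phi> x \<theta> = 0" using \<phi>_bounds[of x \<theta>] x by simp
  then have V: "V x \<theta> = u x" using V_eq[of x \<theta>] x by (simp add: continuation_0)
  obtain a c where ac: "0 < a" "0 < c"
    "\<And>y. 0 \<le> y \<Longrightarrow> y \<le> 1 \<Longrightarrow> c * u (y * a) \<le> continuation \<theta> y"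
    using continuation_lower_bound[of \<theta>] by blast
  define C where "C = u (x / 2) / (x / 2)"
  \<comment> \<open>With \<open>h = y * a\<close> the slope \<open>C / (a * c)\<close> says
    \<open>y * C < c * u h\<close>, and the minimum ensures \<open>y \<le> 1\<close> and
    \<open>y < x / 2\<close>.\<close>
  obtain h where h: "0 < h" "h < min a (a * (x / 2))" "C / (a * c) * h < u h"
    using u_quotient_unbounded[of "min a (a * (x / 2))" "C / (a * c)"] x ac by auto
  define y where "y = h / a"
  have y: "0 < y" "y \<le> 1" "y < x / 2" "y * a = h"
    using h ac x by (auto simp: y_def field_simps)
  have "u (x - y) + continuation \<theta> y \<le> u x" using V_ge[of y x \<theta>] y V x by simp
  moreover have "c * u h \<le> continuation \<theta> y" using ac(3)[of y] y by simp
  moreover have "\<bar>u x - u (x - y)\<bar> \<le> \<bar>x - (x - y)\<bar> * C"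
    unfolding C_def using x y u_0
    by (intro concave_on_lipschitz_away_from_0 u_concave) (auto intro!: monotone_onI u_mono)
  ultimately have "c * u h \<le> y * C" using y by simp
  moreover have "y * C < c * u h"
    using h(3) ac by (simp add: y_def field_simps)
  ultimately show False by simp
qed

section \<open>The envelope formula\<close>

lemma consumption_pos: "0 < x \<Longrightarrow> 0 < consumption \<phi> x \<theta>"
  using \<phi>_less by (simp add: consumption_def)

text \<open>Holding the investment at \<open>\<phi> x \<theta>\<close> while income varies gives a
  differentiable minorant touching \<open>V\<close> at \<open>x\<close>; it is feasible nearby
  because \<open>\<phi> x \<theta> < x\<close>.\<close>

lemma V_has_derivative:
  assumes x: "0 < x"
  shows "((\<lambda>x. V x \<theta>) has_real_derivative deriv u (consumption \<phi> x \<theta>)) (at x)"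
proof (rule concave_on_has_derivative_of_minorant[OF V_concave x])
  let ?W = "\<lambda>t. u (t - \<phi> x \<theta>) + continuation \<theta> (\<phi> x \<theta>)"
  have "(u has_real_derivative deriv u (consumption \<phi> x \<theta>)) (at (x - \<phi> x \<theta>))"
    using u_deriv[OF consumption_pos[OF x, of \<theta>]] by (simp add: consumption_def)
  then have "((\<lambda>t. u (t - \<phi> x \<theta>)) has_real_derivative deriv u (consumption \<phi> x \<theta>)) (at x)"
    using DERIV_shift[of u _ x "- \<phi> x \<theta>"] by simp
  then show "(?W has_real_derivative deriv u (consumption \<phi> x \<theta>)) (at x)"
    by (auto intro!: derivative_eq_intros)
  show "?W x = V x \<theta>" using V_eq x by simp
  have "eventually (\<lambda>t. \<phi> x \<theta> < t) (at x)"
    using \<phi>_less[OF x, of \<theta>] by (intro order_tendstoD(1)[OF tendsto_ident_at])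
  then show "eventually (\<lambda>t. ?W t \<le> V t \<theta>) (at x)"
    by eventually_elim (use V_ge \<phi>_bounds x in auto)
qed

section \<open>Differentiability and the Euler equation\<close>

text \<open>The Euler integrand at a free investment \<open>y\<close>; for \<open>y > 0\<close>,
  multiplied by \<open>- \<gamma>\<close> it is the derivative in \<open>y\<close> of the
  exponential weight.\<close>

definition marginal :: "'s \<Rightarrow> real \<Rightarrow> 's \<Rightarrow> real \<Rightarrow> real" where
  "marginal \<theta> y \<theta>' z = deriv u (consumption \<phi> (f \<theta> y z) \<theta>') * prod_deriv f \<theta> y z *
     exp (log_weight \<theta> y \<theta>' z)"

lemma euler_integrand_eq: "euler_integrand \<gamma> u f V \<phi> x \<theta> \<theta>' = marginal \<theta> (\<phi> x \<theta>) \<theta>'"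
  by (simp add: euler_integrand_def marginal_def log_weight_def fun_eq_iff)

lemma exp_log_weight_has_derivative:
  assumes y: "0 < y" and z: "0 \<le> z"
  shows "((\<lambda>y. exp (log_weight \<theta> y \<theta>' z)) has_real_derivative - \<gamma> * marginal \<theta> y \<theta>' z) (at y)"
proof (cases "f \<theta> y z = 0")
  case True
  \<comment> \<open>The unspecified value \<open>deriv u 0\<close> is harmless: here \<open>f \<theta> \<cdot> z\<close> vanishes identically,
    so \<open>prod_deriv\<close> is \<open>0\<close>.\<close>
  have ev: "eventually (\<lambda>t. f \<theta> t z = 0) (nhds y)"
    using eventually_nhds_in_open[of "{0<..}" y] y f_eq_0[OF z y True]
    by (auto elim!: eventually_mono)
  have "((\<lambda>t. f \<theta> t z) has_real_derivative 0) (at y)"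
    using ev by (subst has_field_derivative_cong_eventually[where g = "\<lambda>_. 0"])
      (auto simp: eventually_nhds_conv_at)
  then have "prod_deriv f \<theta> y z = 0" using DERIV_unique[OF f_deriv[OF z y]] by blast
  moreover have "((\<lambda>y. exp (log_weight \<theta> y \<theta>' z)) has_real_derivative 0) (at y)"
  proof (subst has_field_derivative_cong_eventually[where g = "\<lambda>_. 1"])
    have "eventually (\<lambda>t. exp (log_weight \<theta> t \<theta>' z) = 1) (nhds y)"
      using ev by eventually_elim (simp add: log_weight_def V_0)
    then show "eventually (\<lambda>t. exp (log_weight \<theta> t \<theta>' z) = 1) (at y)"
      "exp (log_weight \<theta> y \<theta>' z) = 1"
      by (auto simp: eventually_nhds_conv_at)
  qed simp
  ultimately show ?thesis by (simp add: marginal_def)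
next
  case False
  then have "0 < f \<theta> y z" using f_nonneg[of y z \<theta>] y z by simp
  then have "((\<lambda>t. V (f \<theta> t z) \<theta>') has_real_derivative
      deriv u (consumption \<phi> (f \<theta> y z) \<theta>') * prod_deriv f \<theta> y z) (at y)"
    by (intro DERIV_chain2[OF V_has_derivative f_deriv[OF z y]])
  then show ?thesis
    unfolding log_weight_def marginal_def by (auto intro!: derivative_eq_intros)
qed

lemma integrable_V_f:
  assumes y: "0 \<le> y"
  shows "integrable \<nu> (\<lambda>z. V (f \<theta> y z) \<theta>')"
proof (rule integrableI_bounded)
  show "(\<lambda>z. V (f \<theta> y z) \<theta>') \<in> borel_measurable \<nu>"
    by (rule compose_f_measurable[OF V_cont y])
  have "(\<integral>\<^sup>+ z. ennreal (norm (V (f \<theta> y z) \<theta>')) \<partial>\<nu>) \<le> (\<integral>\<^sup>+ z. ennreal \<bar>K\<bar> * ennreal (w (f \<theta> y z) \<theta>') \<partial>\<nu>)"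
  proof (rule nn_integral_mono)
    fix z assume "z \<in> space \<nu>"
    then have f: "0 \<le> f \<theta> y z" using y f_nonneg by (simp add: space_\<nu>)
    have "V (f \<theta> y z) \<theta>' \<le> \<bar>K\<bar> * w (f \<theta> y z) \<theta>'"
      using V_le[OF f, of \<theta>'] w_ge_1[OF f, of \<theta>']
      by (smt (verit) mult_right_mono)
    then show "ennreal (norm (V (f \<theta> y z) \<theta>')) \<le> ennreal \<bar>K\<bar> * ennreal (w (f \<theta> y z) \<theta>')"
      using V_nonneg[OF f, of \<theta>'] w_ge_1[OF f, of \<theta>'] by (simp add: ennreal_leI flip: ennreal_mult)
  qed
  also have "\<dots> = ennreal \<bar>K\<bar> * (\<integral>\<^sup>+ z. ennreal (w (f \<theta> y z) \<theta>') \<partial>\<nu>)"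
    using compose_f_measurable[OF w_cont y, of \<theta> \<theta>'] by (intro nn_integral_cmult) auto
  also have "\<dots> < \<infinity>"
    using less_trans[OF growth[OF y] ennreal_less_top] by (simp add: ennreal_mult_less_top)
  finally show "(\<integral>\<^sup>+ z. ennreal (norm (V (f \<theta> y z) \<theta>')) \<partial>\<nu>) < \<infinity>" .
qed

text \<open>Beyond \<open>y / 2\<close> the value of next income is Lipschitz in the investment with
  constant \<open>V (f \<theta> (y / 2) z) \<theta>' / (y / 2)\<close>, and \<open>exp (- a)\<close>
  is Lipschitz for \<open>a \<ge> 0\<close>. The resulting dominating function is integrable by the
  growth bound.\<close>

lemma shows integrable_marginal: "0 < y \<Longrightarrow> integrable \<nu> (marginal \<theta> y \<theta>')"
  and integral_exp_log_weight_has_derivative: "0 < y \<Longrightarrow>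
    ((\<lambda>y. \<integral>z. exp (log_weight \<theta> y \<theta>' z) \<partial>\<nu>) has_real_derivative
      - \<gamma> * (\<integral>z. marginal \<theta> y \<theta>' z \<partial>\<nu>)) (at y)"
proof -
  assume y: "0 < y"
  let ?B = "\<lambda>z. \<gamma> * (V (f \<theta> (y / 2) z) \<theta>' / (y / 2))"
  have bound: "\<bar>exp (log_weight \<theta> t \<theta>' z) - exp (log_weight \<theta> y \<theta>' z)\<bar> \<le> \<bar>t - y\<bar> * ?B z"
    if "t \<in> {y / 2<..}" "z \<in> space \<nu>" for t z
  proof -
    have t: "y / 2 \<le> t" "0 \<le> t" and z: "0 \<le> z" using that y by (auto simp: space_\<nu>)
    have nn: "0 \<le> V (f \<theta> y z) \<theta>'" "0 \<le> V (f \<theta> t z) \<theta>'" "0 \<le> V (f \<theta> 0 z) \<theta>'"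
      using V_nonneg f_nonneg y t z by auto
    have "\<bar>exp (- (\<gamma> * V (f \<theta> t z) \<theta>')) - exp (- (\<gamma> * V (f \<theta> y z) \<theta>'))\<bar>
        \<le> \<bar>\<gamma> * V (f \<theta> t z) \<theta>' - \<gamma> * V (f \<theta> y z) \<theta>'\<bar>"
      using nn \<gamma> by (intro abs_exp_diff_le) auto
    also have "\<dots> = \<gamma> * \<bar>V (f \<theta> t z) \<theta>' - V (f \<theta> y z) \<theta>'\<bar>"
      using \<gamma> by (simp add: abs_mult flip: right_diff_distrib)
    also have "\<dots> \<le> \<gamma> * (\<bar>t - y\<bar> * (V (f \<theta> (y / 2) z) \<theta>' / (y / 2)))"
      using \<gamma> y t nn by (intro mult_left_mono concave_on_lipschitz_away_from_0 V_f_concave V_f_mono z) auto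
    finally show ?thesis by (simp add: log_weight_def mult_ac)
  qed
  have B: "integrable \<nu> ?B" using integrable_V_f[of "y / 2" \<theta> \<theta>'] y by simp
  note * = has_real_derivative_integral[where S = "{y / 2<..}" and y = y and M = \<nu>
      and F = "\<lambda>y z. exp (log_weight \<theta> y \<theta>' z)" and F' = "\<lambda>z. - \<gamma> * marginal \<theta> y \<theta>' z" and B = ?B]
  have "integrable \<nu> (\<lambda>z. - \<gamma> * marginal \<theta> y \<theta>' z)"
    using y bound B by (intro *(1) integrable_exp_log_weight exp_log_weight_has_derivative) (auto simp: space_\<nu>)
  then show "integrable \<nu> (marginal \<theta> y \<theta>')" using \<gamma> by simp
  have "((\<lambda>y. \<integral>z. exp (log_weight \<theta> y \<theta>' z) \<partial>\<nu>) has_real_derivative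
      (\<integral>z. - \<gamma> * marginal \<theta> y \<theta>' z \<partial>\<nu>)) (at y)"
    using y bound B by (intro *(2) integrable_exp_log_weight exp_log_weight_has_derivative) (auto simp: space_\<nu>)
  then show "((\<lambda>y. \<integral>z. exp (log_weight \<theta> y \<theta>' z) \<partial>\<nu>) has_real_derivative
      - \<gamma> * (\<integral>z. marginal \<theta> y \<theta>' z \<partial>\<nu>)) (at y)" by simp
qed

lemma continuation_has_derivative:
  assumes y: "0 < y"
  shows "(continuation \<theta> has_real_derivative
    \<beta> * (mean \<theta> (marginal \<theta> y) / mean \<theta> (\<lambda>\<theta>' z. exp (log_weight \<theta> y \<theta>' z)))) (at y)"
proof -
  let ?m = "\<lambda>y. mean \<theta> (\<lambda>\<theta>' z. exp (log_weight \<theta> y \<theta>' z))"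
  have pos: "0 < ?m y" using y by (intro mean_exp_pos integrable_exp_log_weight) auto
  have "(?m has_real_derivative (\<Sum>\<theta>'\<in>UNIV. p \<theta> \<theta>' * (- \<gamma> * (\<integral>z. marginal \<theta> y \<theta>' z \<partial>\<nu>)))) (at y)"
    unfolding mean_def
    by (intro DERIV_sum DERIV_cmult integral_exp_log_weight_has_derivative y)
  also have "(\<Sum>\<theta>'\<in>UNIV. p \<theta> \<theta>' * (- \<gamma> * (\<integral>z. marginal \<theta> y \<theta>' z \<partial>\<nu>))) = - \<gamma> * mean \<theta> (marginal \<theta> y)"
    by (simp add: mean_def sum_distrib_left sum_negf algebra_simps)
  finally have "((\<lambda>y. ln (?m y)) has_real_derivative 1 / ?m y * (- \<gamma> * mean \<theta> (marginal \<theta> y))) (at y)"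
    using pos by (intro DERIV_chain2[OF DERIV_ln_divide])
  from DERIV_cmult[OF this, of "- (\<beta> / \<gamma>)"] \<gamma> show ?thesis
    unfolding continuation_def[abs_def] log_mean_exp_def by simp
qed

lemma first_order_condition:
  assumes x: "0 < x"
  shows "(continuation \<theta> has_real_derivative deriv u (consumption \<phi> x \<theta>)) (at (\<phi> x \<theta>))"
proof -
  let ?y = "\<phi> x \<theta>"
  have y: "0 < ?y" "?y < x" using \<phi>_pos \<phi>_less x by auto
  obtain d where d: "(continuation \<theta> has_real_derivative d) (at ?y)"
    using continuation_has_derivative[OF y(1)] by blast
  have "(u has_real_derivative deriv u (consumption \<phi> x \<theta>)) (at (x - ?y))"
    using u_deriv[OF consumption_pos[OF x, of \<theta>]] by (simp add: consumption_def)
  moreover have "((\<lambda>y. x - y) has_real_derivative - 1) (at ?y)"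
    by (auto intro!: derivative_eq_intros)
  ultimately have "((\<lambda>y. u (x - y)) has_real_derivative deriv u (consumption \<phi> x \<theta>) * (- 1)) (at ?y)"
    by (rule DERIV_chain2)
  from DERIV_add[OF this d]
  have D: "((\<lambda>y. u (x - y) + continuation \<theta> y) has_real_derivative
      d - deriv u (consumption \<phi> x \<theta>)) (at ?y)" by simp
  have "d - deriv u (consumption \<phi> x \<theta>) = 0"
  proof (rule DERIV_local_max[OF D])
    \<comment> \<open>Within this radius the investment stays between \<open>0\<close> and
      \<open>x\<close>, where \<open>V_ge\<close> applies.\<close>
    show "0 < min ?y (x - ?y)" using y by simp
    show "\<forall>y. \<bar>?y - y\<bar> < min ?y (x - ?y) \<longrightarrow>
        u (x - y) + continuation \<theta> y \<le> u (x - ?y) + continuation \<theta> ?y"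
      using V_ge[of _ x \<theta>] V_eq[of x \<theta>] x by (auto simp: abs_if split: if_splits)
  qed
  then show ?thesis using d by simp
qed

text \<open>The slope of the continuation value at \<open>\<phi> x \<theta>\<close> is known both
  from optimality and from differentiation under the integral; uniqueness of derivatives equates the
  two.\<close>

lemma euler:
  assumes x: "0 < x"
  shows "euler_equation p \<nu> \<beta> \<gamma> u f V \<phi> x \<theta>"
  using DERIV_unique[OF first_order_condition[OF x] continuation_has_derivative[OF \<phi>_pos[OF x]], of \<theta>]
    integrable_marginal[OF \<phi>_pos[OF x]]
  by (simp add: euler_equation_def euler_integrand_eq mean_def log_weight_def)

section \<open>Comparison of first-order conditions\<close>

lemma deriv_u_less:
  assumes "0 < c" "c < c'"
  shows "deriv u c' < deriv u c"
proof -
  have "u c' < u c + deriv u c * (c' - c)" "u c < u c' + deriv u c' * (c - c')"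
    using assms by (auto intro!: strictly_concave_on_below_tangent u_strictly_concave u_deriv)
  then have "deriv u c' * (c' - c) < deriv u c * (c' - c)" by (simp add: algebra_simps)
  then show ?thesis using assms by (simp add: mult_less_cancel_right)
qed

lemma continuation_deriv_le:
  assumes "0 < y" "y \<le> y'" "(continuation \<theta> has_real_derivative d) (at y)"
    "(continuation \<theta> has_real_derivative d') (at y')"
  shows "d' \<le> d"
proof (cases "y = y'")
  case False
  have "continuation \<theta> y' \<le> continuation \<theta> y + d * (y' - y)"
    "continuation \<theta> y \<le> continuation \<theta> y' + d' * (y - y')"
    using assms by (auto intro!: concave_on_below_tangent continuation_concave)
  then have "d' * (y' - y) \<le> d * (y' - y)" by (simp add: algebra_simps)
  then show ?thesis using assms False by (simp add: mult_le_cancel_right)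
qed (use assms DERIV_unique in blast)

text \<open>If investment did not increase, consumption would, so marginal utility would fall while
  the continuation slope would not. The converse comparison is weak: a continuation slope that is
  merely non-increasing does not rule out constant consumption.\<close>

lemma policy_mono:
  assumes x: "0 < x" "x < x'"
  shows "\<phi> x \<theta> < \<phi> x' \<theta>" "consumption \<phi> x \<theta> \<le> consumption \<phi> x' \<theta>"
proof -
  have x': "0 < x'" using x by simp
  note foc = first_order_condition[OF x(1), of \<theta>] first_order_condition[OF x', of \<theta>]
  note pos = \<phi>_pos[OF x(1), of \<theta>] \<phi>_pos[OF x', of \<theta>]
    consumption_pos[OF x(1), of \<theta>] consumption_pos[OF x', of \<theta>]
  show "\<phi> x \<theta> < \<phi> x' \<theta>"
  proof (rule ccontr)
    assume *: "\<not> \<phi> x \<theta> < \<phi> x' \<theta>"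
    then have "consumption \<phi> x \<theta> < consumption \<phi> x' \<theta>" using x by (simp add: consumption_def)
    from deriv_u_less[OF pos(3) this] continuation_deriv_le[OF pos(2) _ foc(2,1)] * show False by simp
  qed
  show "consumption \<phi> x \<theta> \<le> consumption \<phi> x' \<theta>"
  proof (rule ccontr)
    assume *: "\<not> consumption \<phi> x \<theta> \<le> consumption \<phi> x' \<theta>"
    then have "\<phi> x \<theta> \<le> \<phi> x' \<theta>" using x by (simp add: consumption_def)
    from continuation_deriv_le[OF pos(1) this foc] deriv_u_less[OF pos(4), of "consumption \<phi> x \<theta>"] * show False by simp
  qed
qed

section \<open>Strict monotonicity of consumption\<close>

text \<open>For the concave \<open>V\<close>, equality at the midpoint means that \<open>V\<close>
  is affine on the whole interval, so this one equation is what is passed on to the next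
  period.\<close>

lemma V_affine_step:
  assumes x: "0 \<le> x" "x < x'" and mid: "V ((x + x') / 2) \<theta> = (V x \<theta> + V x' \<theta>) / 2"
  obtains \<theta>' t t' where "0 \<le> t" "t < t'" "V ((t + t') / 2) \<theta>' = (V t \<theta>' + V t' \<theta>') / 2"
    "V t' \<theta>' - V t \<theta>' = (V x' \<theta> - V x \<theta>) / \<beta>" "w t' \<theta>' < \<alpha> * w x' \<theta>"
proof -
  define y y' where "y = \<phi> x \<theta>" and "y' = \<phi> x' \<theta>"
  have x': "0 \<le> x'" using x by simp
  have y: "0 \<le> y" "y \<le> x" "0 \<le> y'" "y' \<le> x'"
    using \<phi>_bounds[of x \<theta>] \<phi>_bounds[of x' \<theta>] x by (auto simp: y_def y'_def)
  have Vx: "V x \<theta> = u (x - y) + continuation \<theta> y" "V x' \<theta> = u (x' - y') + continuation \<theta> y'"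
    using V_eq x x' by (auto simp: y_def y'_def)
  have "u ((x + x') / 2 - (y + y') / 2) + continuation \<theta> ((y + y') / 2) \<le> V ((x + x') / 2) \<theta>"
    using y by (intro V_ge) auto
  moreover have "(x + x') / 2 - (y + y') / 2 = ((x - y) + (x' - y')) / 2" by (simp add: field_simps)
  ultimately have V_mid: "u (((x - y) + (x' - y')) / 2) + continuation \<theta> ((y + y') / 2) \<le> V ((x + x') / 2) \<theta>"
    by simp
  have cont_mid: "(continuation \<theta> y + continuation \<theta> y') / 2 \<le> continuation \<theta> ((y + y') / 2)"
    using y by (intro concave_on_mid continuation_concave)
  have u_mid: "(u (x - y) + u (x' - y')) / 2 \<le> u (((x - y) + (x' - y')) / 2)"
    using y by (intro concave_on_mid u_concave) auto
  have V_mid_eq: "V ((x + x') / 2) \<theta>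
      = (u (x - y) + u (x' - y')) / 2 + (continuation \<theta> y + continuation \<theta> y') / 2"
    using mid Vx by (simp add: add_divide_distrib)
  \<comment> \<open>The concavity inequalities for \<open>u\<close> and the continuation value add
    up to an equality, so neither is strict; strict concavity of \<open>u\<close> then equates
    consumption.\<close>
  have c_eq: "x - y = x' - y'"
  proof (rule ccontr)
    assume "x - y \<noteq> x' - y'"
    then have "(u (x - y) + u (x' - y')) / 2 < u (((x - y) + (x' - y')) / 2)"
      using y by (intro strictly_concave_on_mid[OF u_strictly_concave]) auto
    then show False using V_mid cont_mid V_mid_eq by linarith
  qed
  have cont_eq: "continuation \<theta> ((y + y') / 2) = (continuation \<theta> y + continuation \<theta> y') / 2"
    using V_mid cont_mid u_mid V_mid_eq by linarith
  \<comment> \<open>With equal consumption the continuation value carries the whole increment of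
    \<open>V\<close>; removing the discount gives the increment of the next period.\<close>
  define D where "D = (V x' \<theta> - V x \<theta>) / \<beta>"
  have D_eq: "D = (continuation \<theta> y' - continuation \<theta> y) / \<beta>"
    using Vx c_eq by (simp add: D_def)
  have D_pos: "0 < D" using V_strict_mono[OF x, of \<theta>] \<beta> by (simp add: D_def)
  \<comment> \<open>The equality case speaks only of regimes reached with positive probability; one
    is enough.\<close>
  obtain \<theta>' where \<theta>': "0 < p \<theta> \<theta>'" using ex_p_pos by blast
  have lme: "log_mean_exp \<theta> (log_weight \<theta> t) = - (\<gamma> / \<beta>) * continuation \<theta> t" for t
    using \<beta> \<gamma> by (simp add: continuation_def)
  have "AE z in \<nu>. log_weight \<theta> y' \<theta>' z - log_weight \<theta> y \<theta>' z
      = log_mean_exp \<theta> (log_weight \<theta> y') - log_mean_exp \<theta> (log_weight \<theta> y) \<and>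
      log_weight \<theta> ((y + y') / 2) \<theta>' z = (log_weight \<theta> y \<theta>' z + log_weight \<theta> y' \<theta>' z) / 2"
  proof (rule log_mean_exp_midpoint_eq[OF _ _ _ _ _ \<theta>'])
    show "log_weight \<theta> ((y + y') / 2) \<theta>'' z \<le> (log_weight \<theta> y \<theta>'' z + log_weight \<theta> y' \<theta>'' z) / 2"
      if "z \<in> space \<nu>" for \<theta>'' z
      using log_weight_convex[OF that y(1,3), of "1/2" \<theta> \<theta>''] by (simp add: add_divide_distrib)
    show "log_mean_exp \<theta> (log_weight \<theta> ((y + y') / 2))
        = (log_mean_exp \<theta> (log_weight \<theta> y) + log_mean_exp \<theta> (log_weight \<theta> y')) / 2"
      unfolding lme cont_eq by (simp add: algebra_simps add_divide_distrib)
  qed (use y in \<open>auto intro: integrable_exp_log_weight\<close>)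
  then have AE: "AE z in \<nu>. V (f \<theta> y' z) \<theta>' - V (f \<theta> y z) \<theta>' = D \<and>
      V (f \<theta> ((y + y') / 2) z) \<theta>' = (V (f \<theta> y z) \<theta>' + V (f \<theta> y' z) \<theta>') / 2"
  proof eventually_elim
    case (elim z)
    have "\<gamma> * (V (f \<theta> y' z) \<theta>' - V (f \<theta> y z) \<theta>') = \<gamma> * D"
      using elim \<beta> unfolding lme D_eq log_weight_def by (simp add: field_simps)
    moreover have "\<gamma> * V (f \<theta> ((y + y') / 2) z) \<theta>' = \<gamma> * ((V (f \<theta> y z) \<theta>' + V (f \<theta> y' z) \<theta>') / 2)"
      using elim unfolding log_weight_def by (simp add: field_simps)
    ultimately show ?case using \<gamma> by simp
  qed
  \<comment> \<open>If almost every shock had next weight at least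
    \<open>\<alpha> * w x' \<theta>\<close>, so would the mean, against the strict bound
    \<open>growth\<close> and \<open>y' \<le> x'\<close>.\<close>
  have "\<exists>z. z \<in> space \<nu> \<and> w (f \<theta> y' z) \<theta>' < \<alpha> * w x' \<theta> \<and> V (f \<theta> y' z) \<theta>' - V (f \<theta> y z) \<theta>' = D \<and>
      V (f \<theta> ((y + y') / 2) z) \<theta>' = (V (f \<theta> y z) \<theta>' + V (f \<theta> y' z) \<theta>') / 2"
  proof (rule ccontr)
    assume "\<not> ?thesis"
    then have none: "\<alpha> * w x' \<theta> \<le> w (f \<theta> y' z) \<theta>'"
      if "z \<in> space \<nu>" "V (f \<theta> y' z) \<theta>' - V (f \<theta> y z) \<theta>' = D \<and>
        V (f \<theta> ((y + y') / 2) z) \<theta>' = (V (f \<theta> y z) \<theta>' + V (f \<theta> y' z) \<theta>') / 2" for z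
      using that not_less by blast
    have "AE z in \<nu>. \<alpha> * w x' \<theta> \<le> w (f \<theta> y' z) \<theta>'"
      using AE by (rule AE_mp) (use none in blast)
    then have "(\<integral>\<^sup>+z. ennreal (\<alpha> * w x' \<theta>) \<partial>\<nu>) \<le> (\<integral>\<^sup>+z. ennreal (w (f \<theta> y' z) \<theta>') \<partial>\<nu>)"
      by (intro nn_integral_mono_AE) (auto intro: ennreal_leI)
    also have "\<dots> < ennreal (\<alpha> * w y' \<theta>)" using y by (intro growth)
    also have "\<dots> \<le> ennreal (\<alpha> * w x' \<theta>)"
      using monotone_onD[OF w_mono, of y' x' \<theta>] y \<alpha> x' by (intro ennreal_leI mult_left_mono) auto
    finally show False by (simp add: emeasure_space_1)
  qed
  then obtain z where z: "0 \<le> z" "w (f \<theta> y' z) \<theta>' < \<alpha> * w x' \<theta>"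
    "V (f \<theta> y' z) \<theta>' - V (f \<theta> y z) \<theta>' = D"
    "V (f \<theta> ((y + y') / 2) z) \<theta>' = (V (f \<theta> y z) \<theta>' + V (f \<theta> y' z) \<theta>') / 2"
    by (auto simp: space_\<nu>)
  have f: "0 \<le> f \<theta> y z" "0 \<le> f \<theta> y' z" using f_nonneg y z by auto
  show thesis
  proof (rule that[OF f(1) _ _ _ z(2)])
    show "V (f \<theta> y' z) \<theta>' - V (f \<theta> y z) \<theta>' = (V x' \<theta> - V x \<theta>) / \<beta>" using z by (simp add: D_def)
    show "f \<theta> y z < f \<theta> y' z"
      using monotone_onD[OF V_mono, of "f \<theta> y' z" "f \<theta> y z" \<theta>'] f z(3) D_pos by fastforce
    \<comment> \<open>The equality at hand is at the image of the midpoint; concavity of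
      \<open>f\<close> and monotonicity of \<open>V\<close> move it to the midpoint of the
      images.\<close>
    have "V ((f \<theta> y z + f \<theta> y' z) / 2) \<theta>' \<le> V (f \<theta> ((y + y') / 2) z) \<theta>'"
      using f y z f_nonneg concave_on_mid[OF f_concave[OF z(1)] y(1,3), of \<theta>]
      by (intro monotone_onD[OF V_mono]) auto
    then show "V ((f \<theta> y z + f \<theta> y' z) / 2) \<theta>' = (V (f \<theta> y z) \<theta>' + V (f \<theta> y' z) \<theta>') / 2"
      using concave_on_mid[OF V_concave f, of \<theta>'] z(4) by simp
  qed
qed

text \<open>Each period divides the increment by \<beta> and enlarges the weight by less than the
  factor \<alpha>, so going back costs \<open>\<alpha> * \<beta>\<close> per period. Interval and
  regime change each time, hence the generalised induction.\<close>

lemma V_affine_increment_le: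
  assumes "0 \<le> x" "x < x'" "V ((x + x') / 2) \<theta> = (V x \<theta> + V x' \<theta>) / 2"
  shows "V x' \<theta> - V x \<theta> \<le> \<bar>K\<bar> * (\<alpha> * \<beta>) ^ n * w x' \<theta>"
  using assms
proof (induction n arbitrary: x x' \<theta>)
  case 0
  have "V x' \<theta> - V x \<theta> \<le> K * w x' \<theta>" using V_le[of x' \<theta>] V_nonneg[of x \<theta>] 0 by simp
  also have "\<dots> \<le> \<bar>K\<bar> * w x' \<theta>" using w_ge_1[of x' \<theta>] 0 by (intro mult_right_mono) auto
  finally show ?case by simp
next
  case (Suc n)
  obtain \<theta>' t t' where t: "0 \<le> t" "t < t'" "V ((t + t') / 2) \<theta>' = (V t \<theta>' + V t' \<theta>') / 2"
    "V t' \<theta>' - V t \<theta>' = (V x' \<theta> - V x \<theta>) / \<beta>" "w t' \<theta>' < \<alpha> * w x' \<theta>"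
    using V_affine_step[OF Suc.prems] by blast
  have "(V x' \<theta> - V x \<theta>) / \<beta> \<le> \<bar>K\<bar> * (\<alpha> * \<beta>) ^ n * w t' \<theta>'" using Suc.IH[OF t(1-3)] t(4) by simp
  also have "\<dots> \<le> \<bar>K\<bar> * (\<alpha> * \<beta>) ^ n * (\<alpha> * w x' \<theta>)"
    using t(5) \<alpha> \<beta> by (intro mult_left_mono) auto
  finally show ?case using \<beta> by (simp add: field_simps)
qed

text \<open>Otherwise \<open>n\<close> could tend to infinity in the increment bound, leaving a
  non-positive increment of a strictly increasing \<open>V\<close>.\<close>

lemma V_mid_less:
  assumes x: "0 \<le> x" "x < x'"
  shows "(V x \<theta> + V x' \<theta>) / 2 < V ((x + x') / 2) \<theta>"
proof (rule ccontr)
  assume "\<not> ?thesis"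
  then have "V ((x + x') / 2) \<theta> = (V x \<theta> + V x' \<theta>) / 2"
    using concave_on_mid[OF V_concave, of x x' \<theta>] x by simp
  note le = V_affine_increment_le[OF x this]
  have "(\<lambda>n. \<bar>K\<bar> * (\<alpha> * \<beta>) ^ n * w x' \<theta>) \<longlonglongrightarrow> \<bar>K\<bar> * 0 * w x' \<theta>"
    using \<alpha> \<beta> by (intro tendsto_intros LIMSEQ_realpow_zero) auto
  then have "V x' \<theta> - V x \<theta> \<le> \<bar>K\<bar> * 0 * w x' \<theta>"
    using le by (intro LIMSEQ_le_const) auto
  then show False using V_strict_mono[OF x, of \<theta>] by simp
qed

text \<open>Equal consumption means equal slopes of \<open>V\<close> at both ends. The average of
  the two tangent bounds at the midpoint is then the chord, which \<open>V\<close> strictly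
  exceeds.\<close>

lemma consumption_less:
  assumes x: "0 < x" "x < x'"
  shows "consumption \<phi> x \<theta> < consumption \<phi> x' \<theta>"
proof (rule ccontr)
  assume "\<not> ?thesis"
  then have eq: "consumption \<phi> x \<theta> = consumption \<phi> x' \<theta>" using policy_mono(2)[OF x, of \<theta>] by simp
  define s where "s = deriv u (consumption \<phi> x \<theta>)"
  have D: "((\<lambda>x. V x \<theta>) has_real_derivative s) (at x)" "((\<lambda>x. V x \<theta>) has_real_derivative s) (at x')"
    using V_has_derivative[of x \<theta>] V_has_derivative[of x' \<theta>] x eq by (auto simp: s_def)
  have "V ((x + x') / 2) \<theta> \<le> V x \<theta> + s * ((x + x') / 2 - x)"
    "V ((x + x') / 2) \<theta> \<le> V x' \<theta> + s * ((x + x') / 2 - x')"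
    using x by (intro concave_on_below_tangent[OF V_concave _ _ D(1)]
        concave_on_below_tangent[OF V_concave _ _ D(2)]; simp)+
  then have "V ((x + x') / 2) \<theta> \<le> (V x \<theta> + V x' \<theta>) / 2" by (simp add: field_simps)
  then show False using V_mid_less[of x x' \<theta>] x by simp
qed

text \<open>First-order conditions cover positive incomes; at income \<open>0\<close> the investment
  is \<open>0\<close>, and beyond it is positive.\<close>

lemma strict_mono_policy: "strict_mono_on {0..} (\<lambda>x. \<phi> x \<theta>)"
proof (rule strict_mono_onI)
  fix x x' :: real assume "x \<in> {0..}" "x' \<in> {0..}" "x < x'"
  then show "\<phi> x \<theta> < \<phi> x' \<theta>"
    using policy_mono(1)[of x x' \<theta>] \<phi>_bounds[of 0 \<theta>] \<phi>_pos[of x' \<theta>] by (cases "x = 0") auto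
qed

lemma strict_mono_consumption: "strict_mono_on {0..} (\<lambda>x. consumption \<phi> x \<theta>)"
proof (rule strict_mono_onI)
  fix x x' :: real assume "x \<in> {0..}" "x' \<in> {0..}" "x < x'"
  then show "consumption \<phi> x \<theta> < consumption \<phi> x' \<theta>"
    using consumption_less[of x x' \<theta>] \<phi>_bounds[of 0 \<theta>] consumption_pos[of x' \<theta>]
    by (cases "x = 0") (auto simp: consumption_def)
qed

end

theorem theorem5p1:
  fixes p :: "'s::finite \<Rightarrow> 's \<Rightarrow> real"
    and \<nu> :: "real measure"
    and \<beta> \<gamma> :: real
    and u :: "real \<Rightarrow> real"
    and f :: "'s \<Rightarrow> real \<Rightarrow> real \<Rightarrow> real"
    and w V \<phi> :: "real \<Rightarrow> 's \<Rightarrow> real"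
  assumes p: "stochastic_matrix p"
    and \<nu>: "prob_on_halfline \<nu>"
    and \<beta>: "0 < \<beta>" "\<beta> < 1"
    and \<gamma>: "0 < \<gamma>"
    and u_nonneg: "\<And>a. 0 \<le> a \<Longrightarrow> 0 \<le> u a"
    and f_nonneg: "\<And>\<theta> y z. 0 \<le> y \<Longrightarrow> 0 \<le> z \<Longrightarrow> 0 \<le> f \<theta> y z"
    and w: "weight_function w"
    and U1: "strictly_concave_on {0..} u" "strict_mono_on {0..} u"
            "continuous (at 0 within {0..}) u" "u 0 = 0"
    and U2: "\<exists>d>0. \<forall>\<theta>. \<forall>a\<ge>0. u a \<le> d * w a \<theta>"
    and U3: "u C1_differentiable_on {0<..}"
    and U4: "filterlim (\<lambda>h. (u h - u 0) / h) at_top (at_right 0)"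
    and F1: "\<And>\<theta> z. 0 \<le> z \<Longrightarrow> mono_on {0..} (\<lambda>y. f \<theta> y z)"
            "\<And>\<theta> z. 0 \<le> z \<Longrightarrow> continuous_on {0..} (\<lambda>y. f \<theta> y z)"
            "\<And>\<theta> z. 0 \<le> z \<Longrightarrow> concave_on {0..} (\<lambda>y. f \<theta> y z)"
            "\<And>\<theta> y. 0 \<le> y \<Longrightarrow> (\<lambda>z. f \<theta> y z) \<in> borel_measurable (restrict_space borel {0..})"
    and F2: "\<exists>\<alpha>. 0 < \<alpha> \<and> \<alpha> < 1 / \<beta> \<and>
               (\<forall>\<theta>. \<forall>x\<ge>0. (SUP y\<in>{0..x}. SUP \<theta>'. \<integral>\<^sup>+z. ennreal (w (f \<theta> y z) \<theta>') \<partial>\<nu>)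
                             \<le> ennreal (\<alpha> * w x \<theta>))"
    and F3: "\<And>\<theta> z. 0 \<le> z \<Longrightarrow> (\<lambda>y. f \<theta> y z) C1_differentiable_on {0<..}"
    and F4: "\<And>\<theta> z. 0 \<le> z \<Longrightarrow> f \<theta> 0 z = 0"
    and F5: "AE z in \<nu>. \<exists>y>0. \<forall>\<theta>. prod_deriv f \<theta> y z > 0"
    and V: "is_value_function p \<nu> \<beta> \<gamma> u f w V"
    and \<phi>: "is_optimal_policy p \<nu> \<beta> \<gamma> u f V \<phi>"
  shows "(\<forall>x>0. \<forall>\<theta>. euler_equation p \<nu> \<beta> \<gamma> u f V \<phi> x \<theta>) \<and>
         (\<forall>\<theta>. strict_mono_on {0..} (\<lambda>x. \<phi> x \<theta>) \<and>
              strict_mono_on {0..} (\<lambda>x. consumption \<phi> x \<theta>))"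
proof -
  obtain \<alpha>0 where \<alpha>0: "0 < \<alpha>0" "\<alpha>0 < 1 / \<beta>"
    and sup: "\<And>\<theta> x. 0 \<le> x \<Longrightarrow> (SUP y\<in>{0..x}. SUP \<theta>'. \<integral>\<^sup>+z. ennreal (w (f \<theta> y z) \<theta>') \<partial>\<nu>)
      \<le> ennreal (\<alpha>0 * w x \<theta>)"
    using F2 by blast
  \<comment> \<open>slightly more than \<open>\<alpha>0\<close>, which makes the growth bound strict\<close>
  define \<alpha> where "\<alpha> = (\<alpha>0 + 1 / \<beta>) / 2"
  have \<alpha>: "\<alpha>0 < \<alpha>" "\<alpha> < 1 / \<beta>" using \<alpha>0 by (auto simp: \<alpha>_def)
  have w_ge_1: "1 \<le> w x \<theta>" if "0 \<le> x" for x \<theta> using w that by (simp add: weight_function_def)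
  have growth: "(\<integral>\<^sup>+z. ennreal (w (f \<theta> y z) \<theta>') \<partial>\<nu>) < ennreal (\<alpha> * w y \<theta>)" if y: "0 \<le> y" for \<theta> y \<theta>'
  proof -
    have "(\<integral>\<^sup>+z. ennreal (w (f \<theta> y z) \<theta>') \<partial>\<nu>)
        \<le> (SUP y\<in>{0..y}. SUP \<theta>'. \<integral>\<^sup>+z. ennreal (w (f \<theta> y z) \<theta>') \<partial>\<nu>)"
      using y by (intro SUP_upper2[of y] SUP_upper2[of \<theta>']) auto
    also have "\<dots> \<le> ennreal (\<alpha>0 * w y \<theta>)" by (rule sup[OF y])
    also have "\<dots> < ennreal (\<alpha> * w y \<theta>)"
      using \<alpha> \<alpha>0 w_ge_1[OF y, of \<theta>] by (intro ennreal_lessI mult_strict_right_mono) auto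
    finally show ?thesis .
  qed
  have V_space: "V \<in> value_space w" and bellman: "\<And>x \<theta>. 0 \<le> x \<Longrightarrow>
      V x \<theta> = (SUP y\<in>{0..x}. bellman_objective p \<nu> \<beta> \<gamma> u f V x \<theta> y)"
    using V by (auto simp: is_value_function_def)
  have V_props: "mono_on {0..} (\<lambda>x. V x \<theta>)" "0 \<le> x \<Longrightarrow> 0 \<le> V x \<theta>"
    "continuous_on {0..} (\<lambda>x. V x \<theta>)" "concave_on {0..} (\<lambda>x. V x \<theta>)" for x \<theta>
    using V_space unfolding value_space_def by blast+
  have w_props: "continuous_on {0..} (\<lambda>x. w x \<theta>)" "mono_on {0..} (\<lambda>x. w x \<theta>)" for \<theta>
    using w unfolding weight_function_def by blast+
  have \<phi>_props: "0 \<le> \<phi> x \<theta>" "\<phi> x \<theta> \<le> x"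
    "bellman_objective p \<nu> \<beta> \<gamma> u f V x \<theta> (\<phi> x \<theta>) =
      (SUP y\<in>{0..x}. bellman_objective p \<nu> \<beta> \<gamma> u f V x \<theta> y)" if "0 \<le> x" for x \<theta>
    using \<phi> that unfolding is_optimal_policy_def policy_space_def by blast+
  \<comment> \<open>The norm is an extended real below infinity, so some real \<open>K\<close>
    exceeds it and bounds every quotient in the supremum.\<close>
  obtain K where K: "wnorm w V < ereal K"
    using V_space ereal_dense2[of "wnorm w V" \<infinity>] by (auto simp: value_space_def)
  have V_le: "V x \<theta> \<le> K * w x \<theta>" if x: "0 \<le> x" for x \<theta>
  proof -
    have "ereal (\<bar>V x \<theta>\<bar> / w x \<theta>) \<le> wnorm w V"
      unfolding wnorm_def using x by (intro SUP_upper2[of "(x, \<theta>)"]) auto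
    then have "ereal (\<bar>V x \<theta>\<bar> / w x \<theta>) < ereal K" using K by (rule le_less_trans)
    then show ?thesis using w_ge_1[OF x, of \<theta>] by (simp add: divide_less_eq)
  qed
  interpret prob_space \<nu> using \<nu> by (simp add: prob_on_halfline_def)
  interpret growth_model \<nu> p \<beta> \<gamma> \<alpha> K u f w V \<phi>
  proof unfold_locales
    show "sets \<nu> = sets (restrict_space borel {0..})" using \<nu> by (simp add: prob_on_halfline_def)
    show "(u has_real_derivative deriv u c) (at c)" if "0 < c" for c
      using U3 that by (auto simp: C1_differentiable_on_eq DERIV_deriv_iff_real_differentiable)
    show "((\<lambda>y. f \<theta> y z) has_real_derivative prod_deriv f \<theta> y z) (at y)" if "0 \<le> z" "0 < y" for \<theta> y z
      using F3[OF that(1), of \<theta>] that(2)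
      by (auto simp: prod_deriv_def C1_differentiable_on_eq DERIV_deriv_iff_real_differentiable)
    show "\<alpha> * \<beta> < 1" using \<alpha> \<beta> by (simp add: less_divide_eq)
    show "0 < \<alpha>" using \<alpha> \<alpha>0 by simp
    show "filterlim (\<lambda>h. u h / h) at_top (at_right 0)" using U4 U1 by simp
  qed (fact p \<beta> \<gamma> u_nonneg f_nonneg U1 F1 F4 F5 growth w_ge_1 w_props V_props bellman V_le \<phi>_props)+
  show ?thesis using euler strict_mono_policy strict_mono_consumption by blast
qed

end
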